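(* Let $\mathcal{A}$ and $\mathcal{B}$ be complex unital $C^{\star}$-algebras with nonzero identities, and let $T:\mathcal{A}\to\mathcal{B}$ be a bounded homomorphism which has the Riesz property. Let $a\in\mathcal{A}$ be a generalized $T$-Riesz element, with associated finite set $\Omega\subseteq\mathbb{C}$, i.e. $\sigma_{T}(a)=\omega_{T}(a)=\beta_{T}(a)=\Omega$. Then $a$ has a decomposition $a=d+c$ with $c,d\in\mathcal{A}$, where $d$ is a normal element belonging to $T^{-1}(0)$ and $\sigma_{\mathcal{A}}(c)=\Omega$.
   Context: A homomorphism $T:\mathcal{A}\to\mathcal{B}$ is a unital homomorphism of complex algebras (it maps invertible elements to invertible elements); it is not assumed to preserve the involution. $T^{-1}(0)=\{a\in\mathcal{A}: Ta=0\}$. $\mathcal{A}^{-1}$ is the set of invertible elements of $\mathcal{A}$, $e$ is the identity, and $\sigma_{\mathcal{A}}(a)$ is the spectrum of $a$ in $\mathcal{A}$. For a compact set $K\subseteq\mathbb{C}$, $\mathrm{iso}(K)$ is the set of its isolated points and $\mathrm{acc}(K)=K\setminus\mathrm{iso}(K)$. $T$ has the Riesz property if for every $a\in T^{-1}(0)$ one has $\mathrm{acc}(\sigma_{\mathcal{A}}(a))\subseteq\{0\}$. An element $d$ is normal if $dd^{*}=d^{*}d$. The spectra are defined as follows. $\sigma_{T}(a)=\sigma_{\mathcal{B}}(Ta)$ is the spectrum of $Ta$ in $\mathcal{B}$. $\omega_{T}(a)=\{\lambda\in\mathbb{C}: \lambda e-a\notin T^{-1}(0)+\mathcal{A}^{-1}\}$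 is the $T$-Weyl spectrum, where $T^{-1}(0)+\mathcal{A}^{-1}=\{c+d: c\in T^{-1}(0),\ d\in\mathcal{A}^{-1}\}$. $\beta_{T}(a)=\{\lambda\in\mathbb{C}: \lambda e-a\notin T^{-1}(0)+_{com}\mathcal{A}^{-1}\}$ is the $T$-Browder spectrum, where $T^{-1}(0)+_{com}\mathcal{A}^{-1}=\{c+d: c\in T^{-1}(0),\ d\in\mathcal{A}^{-1},\ cd=dc\}$. An element $a\in\mathcal{A}$ is generalized $T$-Riesz (written $a\in GT^{-1}QN(\mathcal{B})$) if there is a finite subset $\Omega\subseteq\mathbb{C}$ such that $\sigma_{T}(a)=\omega_{T}(a)=\beta_{T}(a)=\Omega$. *)

theory Defs
  imports "HOL-Complex_Analysis.Complex_Analysis"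
begin

section \<open>Complex Banach algebras and \<open>C\<^sup>*\<close>-algebras\<close>

text \<open>
  The library has only real normed algebras, so complex scalar multiplication is added here,
  compatibly with the real one.
\<close>

class complex_banach_algebra = real_normed_algebra_1 + banach +
  fixes scaleC :: "complex \<Rightarrow> 'a \<Rightarrow> 'a"  (infixr \<open>*\<^sub>C\<close> 75)
  assumes scaleC_add_right: "z *\<^sub>C (x + y) = z *\<^sub>C x + z *\<^sub>C y"
    and scaleC_add_left: "(z + w) *\<^sub>C x = z *\<^sub>C x + w *\<^sub>C x"
    and scaleC_scaleC: "z *\<^sub>C w *\<^sub>C x = (z * w) *\<^sub>C x"
    and scaleC_of_real: "complex_of_real r *\<^sub>C x = r *\<^sub>R x"
    and mult_scaleC_left: "(z *\<^sub>C x) * y = z *\<^sub>C (x * y)"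
    and mult_scaleC_right: "x * (z *\<^sub>C y) = z *\<^sub>C (x * y)"
    and norm_scaleC: "norm (z *\<^sub>C x) = cmod z * norm x"

text \<open>
  The superclass \<^class>\<open>real_normed_algebra_1\<close> demands \<open>1 \<noteq> 0\<close> and \<open>norm 1 = 1\<close>.  The latter is no
  restriction on a \<open>C\<^sup>*\<close>-algebra with nonzero identity, as it follows from the last axiom below.
\<close>

class cstar_algebra = complex_banach_algebra +
  fixes adj :: "'a \<Rightarrow> 'a"
  assumes adj_adj: "adj (adj x) = x"
    and adj_add: "adj (x + y) = adj x + adj y"
    and adj_scaleC: "adj (z *\<^sub>C x) = cnj z *\<^sub>C adj x"
    and adj_mult: "adj (x * y) = adj y * adj x"
    and norm_adj_mult_self: "norm (adj x * x) = (norm x)\<^sup>2"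

instantiation complex :: cstar_algebra
begin

definition scaleC_complex :: "complex \<Rightarrow> complex \<Rightarrow> complex"
  where "scaleC_complex z x = z * x"

definition adj_complex :: "complex \<Rightarrow> complex"
  where "adj_complex = cnj"

instance
  by standard
    (simp_all add: scaleC_complex_def adj_complex_def algebra_simps scaleR_conv_of_real
      norm_mult power2_eq_square)

end

definition normal_elem :: "'a::cstar_algebra \<Rightarrow> bool"
  where "normal_elem d \<longleftrightarrow> d * adj d = adj d * d"

section \<open>Invertible elements and the spectrum\<close>

definition invertibles :: "'a::complex_banach_algebra set"
  where "invertibles = {x. \<exists>y. x * y = 1 \<and> y * x = 1}"

definition spectrum :: "'a::complex_banach_algebra \<Rightarrow> complex set"
  where "spectrum a = {\<mu>. \<mu> *\<^sub>C 1 - a \<notin> invertibles}"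

definition acc :: "complex set \<Rightarrow> complex set"
  where "acc K = K - isolated_points_of K"

section \<open>Fredholm theory relative to a homomorphism\<close>

definition unital_hom :: "('a::complex_banach_algebra \<Rightarrow> 'b::complex_banach_algebra) \<Rightarrow> bool"
  where "unital_hom T \<longleftrightarrow>
    (\<forall>x y. T (x + y) = T x + T y) \<and> (\<forall>z x. T (z *\<^sub>C x) = z *\<^sub>C T x) \<and>
    (\<forall>x y. T (x * y) = T x * T y) \<and> T 1 = 1"

definition null_space :: "('a::complex_banach_algebra \<Rightarrow> 'b::complex_banach_algebra) \<Rightarrow> 'a set"
  where "null_space T = {a. T a = 0}"

definition riesz_property :: "('a::complex_banach_algebra \<Rightarrow> 'b::complex_banach_algebra) \<Rightarrow> bool"
  where "riesz_property T \<longleftrightarrow> (\<forall>a \<in> null_space T. acc (spectrum a) \<subseteq> {0})"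

definition hom_spectrum ::
    "('a::complex_banach_algebra \<Rightarrow> 'b::complex_banach_algebra) \<Rightarrow> 'a \<Rightarrow> complex set"
  where "hom_spectrum T a = spectrum (T a)"

definition weyl_elems :: "('a::complex_banach_algebra \<Rightarrow> 'b::complex_banach_algebra) \<Rightarrow> 'a set"
  where "weyl_elems T = {c + d | c d. c \<in> null_space T \<and> d \<in> invertibles}"

definition browder_elems :: "('a::complex_banach_algebra \<Rightarrow> 'b::complex_banach_algebra) \<Rightarrow> 'a set"
  where "browder_elems T =
    {c + d | c d. c \<in> null_space T \<and> d \<in> invertibles \<and> c * d = d * c}"

definition weyl_spectrum ::
    "('a::complex_banach_algebra \<Rightarrow> 'b::complex_banach_algebra) \<Rightarrow> 'a \<Rightarrow> complex set"
  where "weyl_spectrum T a = {\<mu>. \<mu> *\<^sub>C 1 - a \<notin> weyl_elems T}"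

definition browder_spectrum ::
    "('a::complex_banach_algebra \<Rightarrow> 'b::complex_banach_algebra) \<Rightarrow> 'a \<Rightarrow> complex set"
  where "browder_spectrum T a = {\<mu>. \<mu> *\<^sub>C 1 - a \<notin> browder_elems T}"

text \<open>
  The finite set in the definition of a generalized \<open>T\<close>-Riesz element is made an argument, since it
  is referred to once the element is given.
\<close>

definition generalized_riesz_with ::
    "('a::complex_banach_algebra \<Rightarrow> 'b::complex_banach_algebra) \<Rightarrow> 'a \<Rightarrow> complex set \<Rightarrow> bool"
  where "generalized_riesz_with T a \<Omega> \<longleftrightarrow>
    finite \<Omega> \<and> hom_spectrum T a = \<Omega> \<and> weyl_spectrum T a = \<Omega> \<and> browder_spectrum T a = \<Omega>"

end

theory Submission
  imports Defs
begin

text \<open>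
  For \<open>\<mu> \<notin> \<Omega>\<close>, the element \<open>\<mu> - a\<close> is a commuting sum of an element of the kernel of \<open>T\<close> and an
  invertible one, so by the Riesz property \<open>\<mu>\<close> is not an accumulation point of the spectrum of
  \<open>a\<close>.  Hence the spectrum outside \<open>\<Omega>\<close> consists of isolated points \<open>\<lambda>\<^sub>0, \<lambda>\<^sub>1, \<dots>\<close> that accumulate
  only at \<open>\<Omega>\<close>; their Riesz idempotents \<open>p\<^sub>i\<close> lie in the kernel of \<open>T\<close>.  Following West, let \<open>Q\<^sub>n\<close> be
  the range projection of \<open>p\<^sub>0 + \<dots> + p\<^sub>n\<^sub>-\<^sub>1\<close>, let \<open>q\<^sub>n = Q\<^sub>n\<^sub>+\<^sub>1 - Q\<^sub>n\<close>, and let \<open>\<omega>\<^sub>n \<in> \<Omega>\<close> be a point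
  nearest to \<open>\<lambda>\<^sub>n\<close>.  The series \<open>d = \<Sum> (\<lambda>\<^sub>n - \<omega>\<^sub>n) q\<^sub>n\<close> converges to a normal element, and with respect
  to the flag \<open>Q\<^sub>n\<close> the element \<open>a - d\<close> is triangular with diagonal blocks whose spectra are
  \<open>{\<omega>\<^sub>n}\<close>; the remaining tail block is a small perturbation of the one of \<open>a\<close>.

  In place of a Cauchy integral, the Riesz idempotent for the unit circle is the limit of \<open>(1 - y\<^sup>n)\<^sup>-\<^sup>1\<close> along \<open>n = 2\<^sup>k\<close>.  The functions
  \<open>F\<^sub>n z = (1 - z y\<^sup>n)\<^sup>-\<^sup>1\<close> satisfy \<open>F\<^sub>2\<^sub>n (z\<^sup>2) = (F\<^sub>n z + F\<^sub>n (- z)) / 2 = F\<^sub>n z F\<^sub>n (- z)\<close>, so that their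
  Lipschitz constants on the circle decrease by the factor \<open>sqrt 2\<close> in each step.
\<close>

section \<open>Inverses in complex Banach algebras\<close>

definition of_complex :: "complex \<Rightarrow> 'a::complex_banach_algebra"
  where "of_complex z = z *\<^sub>C 1"

lemma scaleC_conv_of_complex: "z *\<^sub>C x = of_complex z * x"
  by (simp add: of_complex_def mult_scaleC_left)

lemma of_complex_add: "of_complex (z + w) = of_complex z + of_complex w"
  by (simp add: of_complex_def scaleC_add_left)

lemma of_complex_0 [simp]: "of_complex 0 = 0"
  using of_complex_add[of 0 0] by simp

lemma of_complex_1 [simp]: "of_complex 1 = 1"
  using scaleC_of_real[of 1 1] by (simp add: of_complex_def)

lemma of_complex_mult: "of_complex (z * w) = of_complex z * of_complex w"
  by (simp add: of_complex_def mult_scaleC_left scaleC_scaleC)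

lemma of_complex_minus: "of_complex (- z) = - of_complex z"
  using of_complex_add[of "- z" z] by (simp add: eq_neg_iff_add_eq_0)

lemma of_complex_diff: "of_complex (z - w) = of_complex z - of_complex w"
  using of_complex_add[of z "- w"] by (simp add: of_complex_minus)

lemma of_complex_of_real: "of_complex (complex_of_real r) = r *\<^sub>R 1"
  by (simp add: of_complex_def scaleC_of_real)

lemma norm_of_complex [simp]: "norm (of_complex z :: 'a::complex_banach_algebra) = cmod z"
  by (simp add: of_complex_def norm_scaleC)

lemma norm_of_complex_mult: "norm (of_complex z * x) = cmod z * norm x"
  by (metis norm_scaleC scaleC_conv_of_complex)

lemma of_complex_commute: "x * of_complex z = of_complex z * x"
  by (simp add: of_complex_def mult_scaleC_left mult_scaleC_right)

lemma of_complex_left_commute: "x * (of_complex z * y) = of_complex z * (x * y)"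
  by (metis mult.assoc of_complex_commute)

lemma of_complex_mult_inverse:
  "z \<noteq> 0 \<Longrightarrow> of_complex z * (of_complex (inverse z) * x) = x"
  "z \<noteq> 0 \<Longrightarrow> of_complex (inverse z) * (of_complex z * x) = x"
  by (simp_all flip: mult.assoc of_complex_mult)

lemma bounded_linear_of_complex:
  "bounded_linear (of_complex :: complex \<Rightarrow> 'a::complex_banach_algebra)"
proof (rule bounded_linear_intro[where K = 1])
  fix r :: real and z
  show "of_complex (r *\<^sub>R z) = r *\<^sub>R (of_complex z :: 'a)"
    by (simp add: scaleR_conv_of_real of_complex_mult of_complex_of_real)
qed (simp_all add: of_complex_add)

lemmas tendsto_of_complex [tendsto_intros] = bounded_linear.tendsto[OF bounded_linear_of_complex]

lemma spectrum_iff: "\<mu> \<in> spectrum a \<longleftrightarrow> of_complex \<mu> - a \<notin> invertibles"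
  by (simp add: spectrum_def of_complex_def)

lemma unital_hom_of_complex: "unital_hom T \<Longrightarrow> T (of_complex z) = of_complex z"
  by (simp add: unital_hom_def of_complex_def)

lemma
  assumes "unital_hom T"
  shows unital_hom_add: "T (x + y) = T x + T y" and unital_hom_mult: "T (x * y) = T x * T y"
    and unital_hom_1: "T 1 = 1"
  using assms by (auto simp: unital_hom_def)

lemma unital_hom_diff: "unital_hom T \<Longrightarrow> T (x - y) = T x - T y"
  using unital_hom_add[of T "x - y" y] by simp

lemma unital_hom_0: "unital_hom T \<Longrightarrow> T 0 = 0"
  using unital_hom_diff[of T 0 0] by simp

lemma unital_hom_power: "unital_hom T \<Longrightarrow> T (x ^ n) = T x ^ n"
  by (induction n) (simp_all add: unital_hom_1 unital_hom_mult)

text \<open>A total function, so that limits and bounds of inverses can be stated directly; off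
  \<open>invertibles\<close> its value is unspecified.\<close>

definition invel :: "'a::complex_banach_algebra \<Rightarrow> 'a"
  where "invel x = (THE y. x * y = 1 \<and> y * x = 1)"

lemma invel_unique:
  assumes "x * y = 1" "y * x = 1" shows "invel x = y"
  unfolding invel_def
proof (rule the_equality)
  show "z = y" if "x * z = 1 \<and> z * x = 1" for z
    by (metis assms(2) that mult.assoc mult_1_left mult_1_right)
qed (use assms in simp)

lemma invertiblesI: "x * y = 1 \<Longrightarrow> y * x = 1 \<Longrightarrow> x \<in> invertibles"
  by (auto simp: invertibles_def)

lemma invel_right: "x \<in> invertibles \<Longrightarrow> x * invel x = 1"
  and invel_left: "x \<in> invertibles \<Longrightarrow> invel x * x = 1"
  by (auto simp: invertibles_def invel_unique)

lemma invel_right_assoc: "x \<in> invertibles \<Longrightarrow> x * (invel x * y) = y"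
  and invel_left_assoc: "x \<in> invertibles \<Longrightarrow> invel x * (x * y) = y"
  by (simp_all add: invel_right invel_left flip: mult.assoc)

lemma invel_invel: "x \<in> invertibles \<Longrightarrow> invel (invel x) = x"
  by (blast intro: invel_unique invel_right invel_left)

lemma invertibles_1 [simp]: "1 \<in> invertibles" and invel_1 [simp]: "invel 1 = 1"
  by (auto intro: invertiblesI invel_unique)

lemma invertibles_mult:
  assumes "x \<in> invertibles" "y \<in> invertibles"
  shows "x * y \<in> invertibles" "invel (x * y) = invel y * invel x"
proof -
  have "(x * y) * (invel y * invel x) = 1" "(invel y * invel x) * (x * y) = 1"
    using assms by (simp_all add: mult.assoc invel_right_assoc invel_left_assoc invel_right invel_left)
  then show "x * y \<in> invertibles" "invel (x * y) = invel y * invel x"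
    by (auto intro: invertiblesI invel_unique)
qed

lemma invertibles_of_complex: "z \<noteq> 0 \<Longrightarrow> of_complex z \<in> invertibles"
  by (rule invertiblesI[of _ "of_complex (inverse z)"]) (simp_all flip: of_complex_mult)

lemma invel_commute:
  assumes "x \<in> invertibles" "x * y = y * x"
  shows "invel x * y = y * invel x"
  by (metis assms invel_left invel_right mult.assoc mult_1_left mult_1_right)

lemma unital_hom_invel:
  assumes "unital_hom T" "x \<in> invertibles"
  shows "T x \<in> invertibles" "invel (T x) = T (invel x)"
proof -
  have "T x * T (invel x) = 1" "T (invel x) * T x = 1"
    by (simp_all add: assms invel_right invel_left unital_hom_1 flip: unital_hom_mult)
  then show "T x \<in> invertibles" "invel (T x) = T (invel x)"
    by (auto intro: invertiblesI invel_unique)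
qed

lemma spectrum_unital_hom: "unital_hom T \<Longrightarrow> spectrum (T a) \<subseteq> spectrum a"
  using unital_hom_invel(1)[of T] by (fastforce simp: spectrum_iff unital_hom_diff unital_hom_of_complex)

section \<open>Neumann series, continuity of inversion and closedness of the spectrum\<close>

lemma invel_diff:
  assumes "x \<in> invertibles" "y \<in> invertibles"
  shows "invel x - invel y = invel x * (y - x) * invel y"
  using assms by (simp add: algebra_simps invel_right invel_left_assoc)

lemma Neumann_invertible:
  fixes x :: "'a::complex_banach_algebra"
  assumes "norm x < 1"
  shows "1 - x \<in> invertibles" "norm (invel (1 - x)) \<le> 1 / (1 - norm x)"
proof -
  have sx: "summable (\<lambda>n. x ^ n)" "summable (\<lambda>n. norm (x ^ n))"
    using assms complete_algebra_summable_geometric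
    by (auto intro!: summable_comparison_test'[OF summable_geometric[of "norm x"]] norm_power_ineq)
  define s where "s = (\<Sum>n. x ^ n)"
  have "s = (\<Sum>n. x ^ Suc n) + 1"
    using suminf_split_head[OF sx(1)] by (simp add: s_def)
  moreover have "(\<Sum>n. x ^ Suc n) = x * s" "(\<Sum>n. x ^ Suc n) = s * x"
    unfolding s_def using suminf_mult[OF sx(1), of x] suminf_mult2[OF sx(1), of x]
    by (simp_all add: power_commutes)
  ultimately have "(1 - x) * s = 1" "s * (1 - x) = 1"
    by (simp_all add: algebra_simps)
  then show "1 - x \<in> invertibles" by (rule invertiblesI)
  have "norm s \<le> (\<Sum>n. norm x ^ n)"
    unfolding s_def using sx assms
    by (intro order_trans[OF summable_norm[OF sx(2)]] suminf_le norm_power_ineq summable_geometric) auto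
  then show "norm (invel (1 - x)) \<le> 1 / (1 - norm x)"
    using \<open>(1 - x) * s = 1\<close> \<open>s * (1 - x) = 1\<close> assms
    by (simp add: invel_unique suminf_geometric)
qed

lemma spectrum_norm_le:
  assumes "\<mu> \<in> spectrum a" shows "cmod \<mu> \<le> norm a"
proof (rule ccontr)
  assume *: "\<not> cmod \<mu> \<le> norm a"
  then have "\<mu> \<noteq> 0" by auto
  have "norm (of_complex (inverse \<mu>) * a) < 1"
    using * \<open>\<mu> \<noteq> 0\<close> by (simp add: norm_of_complex_mult norm_divide field_simps)
  then have "of_complex \<mu> * (1 - of_complex (inverse \<mu>) * a) \<in> invertibles"
    using \<open>\<mu> \<noteq> 0\<close> by (intro invertibles_mult invertibles_of_complex Neumann_invertible)
  moreover have "of_complex \<mu> * (1 - of_complex (inverse \<mu>) * a) = of_complex \<mu> - a"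
    using \<open>\<mu> \<noteq> 0\<close> by (simp add: right_diff_distrib of_complex_mult_inverse)
  ultimately show False using assms by (simp add: spectrum_iff)
qed

text \<open>Factor y = x (1 - u), where u = x^-1 (x - y) has norm at most 1/2; the Neumann bound 1 /
  (1 - norm u) is then at most 2.\<close>

lemma perturbed_invertible:
  fixes x :: "'a::complex_banach_algebra"
  assumes x: "x \<in> invertibles" and h: "norm (invel x) * norm (y - x) \<le> 1/2"
  shows "y \<in> invertibles" "norm (invel y) \<le> 2 * norm (invel x)"
proof -
  define u where "u = invel x * (x - y)"
  have u: "norm u \<le> 1/2"
    unfolding u_def using h norm_mult_ineq[of "invel x" "x - y"] by (simp add: norm_minus_commute)
  have y: "y = x * (1 - u)"
    using x by (simp add: u_def right_diff_distrib invel_right_assoc invel_left)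
  have inv: "1 - u \<in> invertibles" "norm (invel (1 - u)) \<le> 1 / (1 - norm u)"
    using u by (auto intro: Neumann_invertible)
  show "y \<in> invertibles"
    unfolding y using x inv by (intro invertibles_mult)
  have "norm (invel y) \<le> norm (invel (1 - u)) * norm (invel x)"
    unfolding y using x inv by (simp add: invertibles_mult norm_mult_ineq)
  also have "1 / (1 - norm u) \<le> 2" using u by (simp add: field_simps)
  then have "norm (invel (1 - u)) * norm (invel x) \<le> 2 * norm (invel x)"
    using inv by (intro mult_right_mono) auto
  finally show "norm (invel y) \<le> 2 * norm (invel x)" .
qed

text \<open>Near an invertible x the inverses are bounded by \<open>2 * norm (invel x)\<close>; with
  \<open>invel_diff\<close> this bounds the change of the inverse by a multiple of
  \<open>norm (f t - x)\<close>.\<close>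

lemma
  fixes f :: "'b \<Rightarrow> 'a::complex_banach_algebra"
  assumes f: "(f \<longlongrightarrow> x) F" and x: "x \<in> invertibles"
  shows eventually_invertible: "\<forall>\<^sub>F t in F. f t \<in> invertibles"
    and tendsto_invel: "((\<lambda>t. invel (f t)) \<longlongrightarrow> invel x) F"
proof -
  have "((\<lambda>t. norm (invel x) * norm (f t - x)) \<longlongrightarrow> norm (invel x) * norm (x - x)) F"
    by (intro tendsto_intros f)
  then have ev: "\<forall>\<^sub>F t in F. norm (invel x) * norm (f t - x) < 1/2"
    by (rule order_tendstoD) simp
  then show "\<forall>\<^sub>F t in F. f t \<in> invertibles"
    by eventually_elim (use x perturbed_invertible(1) in force)
  have "((\<lambda>t. 2 * norm (invel x) * norm (f t - x) * norm (invel x)) \<longlongrightarrow>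
      2 * norm (invel x) * norm (x - x) * norm (invel x)) F"
    by (intro tendsto_intros f)
  then have lim: "((\<lambda>t. 2 * norm (invel x) * norm (f t - x) * norm (invel x)) \<longlongrightarrow> 0) F"
    by simp
  have "\<forall>\<^sub>F t in F. norm (invel (f t) - invel x) \<le> 2 * norm (invel x) * norm (f t - x) * norm (invel x)"
    using ev
  proof eventually_elim
    case (elim t)
    have ft: "f t \<in> invertibles" "norm (invel (f t)) \<le> 2 * norm (invel x)"
      using perturbed_invertible[OF x, of "f t"] elim by auto
    have "norm (invel (f t) - invel x) \<le> norm (invel (f t)) * norm (x - f t) * norm (invel x)"
      unfolding invel_diff[OF ft(1) x]
      by (intro order_trans[OF norm_mult_ineq] mult_right_mono) (auto simp: norm_mult_ineq)
    also have "\<dots> \<le> 2 * norm (invel x) * norm (f t - x) * norm (invel x)"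
      unfolding norm_minus_commute[of x] using ft by (intro mult_right_mono) auto
    finally show ?case .
  qed
  then have "((\<lambda>t. invel (f t) - invel x) \<longlongrightarrow> 0) F"
    by (rule Lim_null_comparison[OF _ lim])
  then show "((\<lambda>t. invel (f t)) \<longlongrightarrow> invel x) F"
    by (simp add: LIM_zero_iff)
qed

lemma closed_spectrum: "closed (spectrum a)"
proof -
  have "open (- spectrum a)"
  proof (rule Topological_Spaces.openI)
    fix \<mu> assume "\<mu> \<in> - spectrum a"
    then have "\<forall>\<^sub>F z in nhds \<mu>. of_complex z - a \<in> invertibles"
      by (intro eventually_invertible[of _ "of_complex \<mu> - a"] tendsto_intros filterlim_ident)
        (simp add: spectrum_iff)
    then show "\<exists>S. open S \<and> \<mu> \<in> S \<and> S \<subseteq> - spectrum a"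
      by (auto simp: eventually_nhds spectrum_iff)
  qed
  then show ?thesis by (simp add: closed_def)
qed

lemma bounded_invel_on_compact:
  fixes y :: "'a::complex_banach_algebra"
  assumes "compact K" and "\<And>z. z \<in> K \<Longrightarrow> 1 - of_complex z * y \<in> invertibles"
  obtains M where "0 \<le> M" "\<And>z. z \<in> K \<Longrightarrow> norm (invel (1 - of_complex z * y)) \<le> M"
proof -
  have "continuous_on K (\<lambda>z. invel (1 - of_complex z * y))"
    unfolding continuous_on
  proof
    fix z assume "z \<in> K"
    then show "((\<lambda>z. invel (1 - of_complex z * y)) \<longlongrightarrow> invel (1 - of_complex z * y)) (at z within K)"
      by (intro tendsto_invel tendsto_intros assms)
  qed
  then have "bounded ((\<lambda>z. invel (1 - of_complex z * y)) ` K)"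
    by (intro compact_imp_bounded compact_continuous_image assms)
  then obtain M where "\<forall>z\<in>K. norm (invel (1 - of_complex z * y)) \<le> M"
    by (auto simp: bounded_iff)
  then show thesis
    by (intro that[of "max M 0"]) auto
qed

section \<open>Inverses in corner algebras\<close>

text \<open>\<open>w\<close> is an inverse of \<open>q x q\<close> in the corner algebra with unit \<open>q\<close>.\<close>
definition corner_inv :: "'a::complex_banach_algebra \<Rightarrow> 'a \<Rightarrow> 'a \<Rightarrow> bool"
  where "corner_inv q x w \<longleftrightarrow> q * w = w \<and> w * q = w \<and> w * x * q = q \<and> q * x * w = q"

lemma corner_inv_1: "corner_inv 1 x w \<longleftrightarrow> w * x = 1 \<and> x * w = 1"
  by (auto simp: corner_inv_def)

lemma corner_inv_0: "corner_inv 0 x 0"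
  by (simp add: corner_inv_def)

text \<open>Since w = q w = w q, only the compression \<open>q * x * q\<close> enters the defining
  equations. This allows a perturbation of an element to be replaced by a scalar shift on a block
  where the two compress equally.\<close>

lemma corner_inv_cong:
  assumes "q * x * q = q * y * q" "corner_inv q x w" shows "corner_inv q y w"
proof -
  have w: "q * w = w" "w * q = w" "w * x * q = q" "q * x * w = q"
    using assms(2) by (auto simp: corner_inv_def)
  have "w * y * q = w * (q * y * q)" "w * x * q = w * (q * x * q)"
    by (metis w(2) mult.assoc)+
  moreover have "q * y * w = (q * y * q) * w" "q * x * w = (q * x * q) * w"
    by (metis w(1) mult.assoc)+
  ultimately show ?thesis
    using w assms(1) by (simp add: corner_inv_def)
qed

lemma corner_inv_commute:
  assumes "corner_inv q x w" "q * q = q" "x * q = q * x" "y * x = x * y" "y * q = q * y"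
  shows "y * w = w * y"
proof -
  have w: "q * w = w" "w * q = w" "w * x * q = q" "q * x * w = q"
    using assms(1) by (auto simp: corner_inv_def)
  have "w * y = w * q * y" using w by simp
  also have "\<dots> = w * y * q" using assms by (simp add: mult.assoc)
  also have "\<dots> = w * y * (q * x * w)" using w by simp
  also have "\<dots> = w * (y * q) * x * w" by (simp add: mult.assoc)
  also have "\<dots> = w * (q * (y * x)) * w" using assms by (simp add: mult.assoc)
  also have "\<dots> = w * (q * x) * y * w" using assms by (simp add: mult.assoc)
  also have "\<dots> = (w * x * q) * y * w" using assms by (simp add: mult.assoc)
  also have "\<dots> = y * w" using w assms by (metis mult.assoc)
  finally show ?thesis by simp
qed

lemma corner_inv_of_invertible:
  assumes "x \<in> invertibles" "q * q = q" "q * x = x * q"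
  shows "corner_inv q x (invel x * q)"
proof -
  have c: "invel x * q = q * invel x" using assms by (intro invel_commute) simp_all
  have "q * (invel x * q) = invel x * q" "invel x * q * q = invel x * q"
    using assms c by (metis mult.assoc)+
  moreover have "invel x * q * x * q = q" "q * x * (invel x * q) = q"
    using assms c by (metis invel_left invel_right mult.assoc mult_1_left mult_1_right)+
  ultimately show ?thesis by (simp add: corner_inv_def)
qed

lemma corner_inv_scale:
  assumes "corner_inv q x w" "r \<noteq> 0"
  shows "corner_inv q (of_complex r * x) (of_complex (inverse r) * w)"
  using assms
  by (simp add: corner_inv_def mult.assoc of_complex_mult_inverse of_complex_left_commute[of q]
      of_complex_left_commute[of w] of_complex_left_commute[of x])

text \<open>Once \<open>x * y n\<close> is close to q, its compression s is invertible in the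
  corner: \<open>1 - (q - s)\<close> acts as s there and as the identity on the complement, and it
  is inverted in the whole algebra.\<close>

lemma corner_inv_approx:
  fixes x :: "'a::complex_banach_algebra" and y :: "nat \<Rightarrow> 'a"
  assumes q: "q * q = q" "q * x = x * q" and y: "\<And>n. x * y n = y n * x"
    and lim: "(\<lambda>n. x * y n) \<longlonglongrightarrow> q"
  shows "\<exists>w. corner_inv q x w"
proof -
  have "(\<lambda>n. 1 - (q - q * (x * y n) * q)) \<longlonglongrightarrow> 1 - (q - q * q * q)"
    by (intro tendsto_intros lim)
  then have "(\<lambda>n. 1 - (q - q * (x * y n) * q)) \<longlonglongrightarrow> 1" using q by simp
  then have "\<forall>\<^sub>F n in sequentially. 1 - (q - q * (x * y n) * q) \<in> invertibles"
    by (rule eventually_invertible) simp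
  then obtain n where n: "1 - (q - q * (x * y n) * q) \<in> invertibles"
    by (auto simp: eventually_sequentially)
  define s where "s = q * (x * y n) * q"
  define u where "u = 1 - (q - s)"
  define v where "v = invel u"
  have "q * (q * z * q) = q * z * q" "(q * z * q) * q = q * z * q" for z
    using q(1) by (metis mult.assoc)+
  then have qs: "q * s = s" "s * q = s" by (simp_all add: s_def)
  have uq: "u * q = s" "q * u = s" using q qs by (simp_all add: u_def algebra_simps)
  have "u \<in> invertibles" using n by (simp add: u_def s_def)
  note uv = invel_right[OF this, folded v_def] invel_left[OF this, folded v_def]
  have "s * x = q * (x * y n * x) * q" using q by (simp add: s_def mult.assoc)
  also have "x * y n * x = x * (x * y n)" by (metis y mult.assoc)
  also have "q * (x * (x * y n)) * q = x * s" by (metis s_def q(2) mult.assoc)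
  finally have sx: "s * x = x * s" .
  have "u * x = x * u" using sx q by (simp add: u_def algebra_simps)
  then have vx: "v * x = x * v" unfolding v_def by (rule invel_commute[OF \<open>u \<in> _\<close>])
  have vq: "v * q = q * v" unfolding v_def by (rule invel_commute[OF \<open>u \<in> _\<close>]) (simp add: uq)
  have sv: "s * v = q" "v * s = q"
  proof -
    have "s * v = q * (u * v)" using uq by (simp flip: mult.assoc)
    then show "s * v = q" using uv by simp
    have "v * s = (v * u) * q" using uq by (simp add: mult.assoc)
    then show "v * s = q" using uv by simp
  qed
  \<comment> \<open>Only x is known to commute with \<open>y n\<close>, so \<open>y n\<close> is
    compressed by q on both sides.\<close>
  define w where "w = q * y n * q * v"
  have "q * w = w" by (simp add: w_def q flip: mult.assoc)
  moreover have "w * q = w" by (simp add: w_def mult.assoc vq) (simp add: q flip: mult.assoc)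
  moreover have "x * w = q"
  proof -
    have "x * w = s * v" using q by (simp add: w_def s_def flip: mult.assoc)
    then show ?thesis using sv by simp
  qed
  moreover have "w * x = q"
  proof -
    have "w * x = q * y n * q * (v * x)" by (simp add: w_def mult.assoc)
    also have "\<dots> = q * y n * (q * x) * v" by (simp add: vx mult.assoc)
    also have "\<dots> = q * (y n * x) * q * v" by (simp add: q mult.assoc)
    also have "\<dots> = s * v" by (simp add: s_def y)
    finally show ?thesis using sv by simp
  qed
  ultimately have "corner_inv q x w" using q by (simp add: corner_inv_def mult.assoc)
  then show ?thesis ..
qed

text \<open>The factor is the geometric sum of the terms \<mu>^(n-1-i) x^i for i < n, built by the
  recursion that sends g to \<mu> g + x^n.\<close>

lemma geometric_factor:
  "\<exists>g. (of_complex \<mu> - x) * g = of_complex (\<mu> ^ n) - x ^ n \<and> g * (of_complex \<mu> - x) = of_complex (\<mu> ^ n) - x ^ n"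
proof (induction n)
  case 0
  show ?case by (intro exI[of _ 0]) simp
next
  case (Suc n)
  then obtain g where g: "(of_complex \<mu> - x) * g = of_complex (\<mu> ^ n) - x ^ n"
      "g * (of_complex \<mu> - x) = of_complex (\<mu> ^ n) - x ^ n" by auto
  let ?h = "of_complex \<mu> * g + x ^ n"
  have "(of_complex \<mu> - x) * ?h = of_complex \<mu> * ((of_complex \<mu> - x) * g) + (of_complex \<mu> - x) * x ^ n"
    by (simp add: distrib_left of_complex_left_commute[of "of_complex \<mu> - x"])
  also have "\<dots> = of_complex (\<mu> ^ Suc n) - x ^ Suc n"
    unfolding g by (simp add: algebra_simps of_complex_mult)
  finally have 1: "(of_complex \<mu> - x) * ?h = of_complex (\<mu> ^ Suc n) - x ^ Suc n" .
  have "?h * (of_complex \<mu> - x) = of_complex \<mu> * (g * (of_complex \<mu> - x)) + x ^ n * (of_complex \<mu> - x)"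
    by (simp add: distrib_right mult.assoc)
  also have "\<dots> = of_complex (\<mu> ^ Suc n) - x ^ Suc n"
    unfolding g by (simp add: algebra_simps of_complex_mult of_complex_commute[of "x ^ n"] power_commutes)
  finally show ?case using 1 by blast
qed

section \<open>Resolvents of dyadic powers\<close>

text \<open>For a scalar y the value at z = 1 tends to 1 if \<bar>y\<bar> < 1 and to 0 if
  \<bar>y\<bar> > 1. The limit thus singles out the part of the spectrum inside the unit
  circle.\<close>

definition dyadic_res :: "'a::complex_banach_algebra \<Rightarrow> nat \<Rightarrow> complex \<Rightarrow> 'a"
  where "dyadic_res y k z = invel (1 - of_complex z * y ^ 2 ^ k)"

text \<open>With X = \<open>of_complex z * y ^ 2 ^ k\<close> this is the partial fraction
  decomposition of 1 / (1 - X^2). The average controls Lipschitz constants, and the product makes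
  the limit idempotent.\<close>

lemma dyadic_res_square:
  assumes "1 - of_complex z * y ^ 2 ^ k \<in> invertibles" "1 - of_complex (- z) * y ^ 2 ^ k \<in> invertibles"
  shows "1 - of_complex (z\<^sup>2) * y ^ 2 ^ Suc k \<in> invertibles"
    and "dyadic_res y (Suc k) (z\<^sup>2) = (1/2) *\<^sub>R (dyadic_res y k z + dyadic_res y k (- z))"
    and "dyadic_res y (Suc k) (z\<^sup>2) = dyadic_res y k z * dyadic_res y k (- z)"
proof -
  define X where "X = of_complex z * y ^ 2 ^ k"
  have XX: "of_complex (z\<^sup>2) * y ^ 2 ^ Suc k = X * X"
  proof -
    have "y ^ 2 ^ Suc k = y ^ 2 ^ k * y ^ 2 ^ k" by (simp add: mult_2 power_add)
    then show ?thesis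
      by (simp add: X_def power2_eq_square of_complex_mult mult.assoc of_complex_left_commute[of "y ^ 2 ^ k"])
  qed
  have eq: "1 - X * X = (1 + X) * (1 - X)" by (simp add: algebra_simps)
  have inv: "1 - X \<in> invertibles" "1 + X \<in> invertibles"
    using assms by (simp_all add: X_def of_complex_minus)
  define u v where "u = invel (1 - X)" and "v = invel (1 + X)"
  have u: "dyadic_res y k z = u" and v: "dyadic_res y k (- z) = v"
    by (simp_all add: dyadic_res_def u_def v_def X_def of_complex_minus)
  show "1 - of_complex (z\<^sup>2) * y ^ 2 ^ Suc k \<in> invertibles"
    unfolding XX eq using inv by (intro invertibles_mult)
  show uv: "dyadic_res y (Suc k) (z\<^sup>2) = dyadic_res y k z * dyadic_res y k (- z)"
    unfolding u v unfolding dyadic_res_def XX eq u_def v_def using inv by (intro invertibles_mult)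
  have "u + v = u * ((1 + X) * v) + (u * (1 - X)) * v"
    using inv by (simp add: u_def v_def invel_left invel_right)
  also have "\<dots> = 2 *\<^sub>R (u * v)"
    by (simp add: algebra_simps scaleR_2)
  finally show "dyadic_res y (Suc k) (z\<^sup>2) = (1/2) *\<^sub>R (dyadic_res y k z + dyadic_res y k (- z))"
    unfolding uv unfolding u v by simp
qed

lemma dyadic_invertible:
  assumes "\<And>z. cmod z = 1 \<Longrightarrow> 1 - of_complex z * y \<in> invertibles" "cmod z = 1"
  shows "1 - of_complex z * y ^ 2 ^ k \<in> invertibles"
  using assms(2)
proof (induction k arbitrary: z)
  case 0
  then show ?case using assms(1) by simp
next
  case (Suc k)
  have "cmod (csqrt z) = 1" using Suc.prems by (simp add: norm_csqrt)
  then have "1 - of_complex ((csqrt z)\<^sup>2) * y ^ 2 ^ Suc k \<in> invertibles"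
    by (intro dyadic_res_square(1) Suc.IH) auto
  then show ?case by simp
qed

text \<open>Changing the sign of t if necessary gives \<bar>s - t\<bar> \<le> \<bar>s + t\<bar>. The
  parallelogram law then yields \<bar>s + t\<bar> \<ge> sqrt 2, and s^2 - t^2 = (s - t) (s +
  t).\<close>

lemma unit_circle_square_roots:
  assumes "cmod z = 1" "cmod w = 1"
  obtains s t where "z = s\<^sup>2" "w = t\<^sup>2" "cmod s = 1" "cmod t = 1" "cmod (s - t) \<le> cmod (z - w) / sqrt 2"
proof -
  have *: "cmod (s - t) \<le> cmod (s\<^sup>2 - t\<^sup>2) / sqrt 2"
    if "cmod s = 1" "cmod t = 1" "cmod (s - t) \<le> cmod (s + t)" for s t
  proof -
    have "(cmod (s - t))\<^sup>2 + (cmod (s + t))\<^sup>2 = 4"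
    proof -
      have "(cmod (s - t))\<^sup>2 + (cmod (s + t))\<^sup>2 = 2 * (cmod s)\<^sup>2 + 2 * (cmod t)\<^sup>2"
        unfolding cmod_power2 by (simp add: power2_eq_square algebra_simps)
      then show ?thesis using that by simp
    qed
    moreover have "(cmod (s - t))\<^sup>2 \<le> (cmod (s + t))\<^sup>2"
      using that by (intro power_mono) auto
    ultimately have "2 \<le> (cmod (s + t))\<^sup>2" by linarith
    then have "sqrt 2 \<le> cmod (s + t)"
      by (intro real_le_lsqrt) auto
    then have "cmod (s - t) * sqrt 2 \<le> cmod (s - t) * cmod (s + t)"
      by (intro mult_left_mono) auto
    also have "\<dots> = cmod (s\<^sup>2 - t\<^sup>2)"
      by (simp add: power2_eq_square algebra_simps flip: norm_mult)
    finally show ?thesis by (simp add: field_simps)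
  qed
  define s t where "s = csqrt z" and "t = csqrt w"
  have st: "z = s\<^sup>2" "w = t\<^sup>2" "cmod s = 1" "cmod t = 1"
    using assms by (simp_all add: s_def t_def norm_csqrt)
  show thesis
  proof (cases "cmod (s - t) \<le> cmod (s + t)")
    case True
    then show ?thesis using st * by (intro that[of s t]) auto
  next
    case False
    then show ?thesis using st *[of s "- t"] by (intro that[of s "- t"]) auto
  qed
qed

text \<open>Averaging keeps the Lipschitz constant, while passing to well-chosen square roots
  shrinks distances by sqrt 2. The initial constant comes from compactness of the circle.\<close>

lemma dyadic_res_lipschitz:
  fixes y :: "'a::complex_banach_algebra"
  assumes inv: "\<And>z. cmod z = 1 \<Longrightarrow> 1 - of_complex z * y \<in> invertibles"
  obtains L where "0 \<le> L"
    "\<And>k z w. cmod z = 1 \<Longrightarrow> cmod w = 1 \<Longrightarrow>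
      norm (dyadic_res y k z - dyadic_res y k w) \<le> L * (1 / sqrt 2) ^ k * cmod (z - w)"
proof -
  obtain M where M: "0 \<le> M" "\<And>z. cmod z = 1 \<Longrightarrow> norm (invel (1 - of_complex z * y)) \<le> M"
    using bounded_invel_on_compact[of "sphere 0 1" y] inv by (auto simp: dist_norm)
  define L where "L = M * norm y * M"
  have "norm (dyadic_res y k z - dyadic_res y k w) \<le> L * (1 / sqrt 2) ^ k * cmod (z - w)"
    if "cmod z = 1" "cmod w = 1" for k z w
    using that
  proof (induction k arbitrary: z w)
    case 0
    have "dyadic_res y 0 z - dyadic_res y 0 w =
        dyadic_res y 0 z * (of_complex (z - w) * y) * dyadic_res y 0 w"
      using 0 inv by (simp add: dyadic_res_def invel_diff of_complex_diff algebra_simps)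
    also have "norm \<dots> \<le> norm (dyadic_res y 0 z) * norm (of_complex (z - w) * y) * norm (dyadic_res y 0 w)"
      by (intro order_trans[OF norm_mult_ineq] mult_right_mono) (auto simp: norm_mult_ineq)
    also have "\<dots> \<le> M * norm (of_complex (z - w) * y) * M"
      using 0 M by (intro mult_mono) (auto simp: dyadic_res_def)
    also have "\<dots> = L * cmod (z - w)"
      by (simp add: L_def norm_of_complex_mult)
    finally show ?case by simp
  next
    case (Suc k)
    obtain s t where st: "z = s\<^sup>2" "w = t\<^sup>2" "cmod s = 1" "cmod t = 1"
      "cmod (s - t) \<le> cmod (z - w) / sqrt 2"
      using unit_circle_square_roots Suc.prems by blast
    define D where "D = (\<lambda>z w. dyadic_res y k z - dyadic_res y k w)"
    have "dyadic_res y (Suc k) z - dyadic_res y (Suc k) w = (1/2) *\<^sub>R (D s t + D (- s) (- t))"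
      using st by (simp add: dyadic_res_square dyadic_invertible[OF inv] D_def algebra_simps)
    also have "norm \<dots> \<le> (1/2) * (norm (D s t) + norm (D (- s) (- t)))"
      using norm_triangle_ineq by simp
    also have "\<dots> \<le> (1/2) * (L * (1 / sqrt 2) ^ k * cmod (s - t) + L * (1 / sqrt 2) ^ k * cmod (- s - - t))"
      unfolding D_def using st by (intro mult_left_mono add_mono Suc.IH) auto
    also have "cmod (- s - - t) = cmod (s - t)" by (simp add: norm_minus_commute)
    also have "(1/2) * (L * (1 / sqrt 2) ^ k * cmod (s - t) + L * (1 / sqrt 2) ^ k * cmod (s - t))
        = L * (1 / sqrt 2) ^ k * cmod (s - t)"
      by simp
    also have "\<dots> \<le> L * (1 / sqrt 2) ^ k * (cmod (z - w) / sqrt 2)"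
      using st M by (intro mult_left_mono) (auto simp: L_def)
    finally show ?case by simp
  qed
  moreover have "0 \<le> L" using M by (simp add: L_def)
  ultimately show thesis using that by blast
qed

text \<open>Consecutive terms at 1 differ by half the difference of the values at - 1 and 1, which
  decays geometrically. Both values therefore have the same limit, and the product formula makes it
  idempotent.\<close>

lemma dyadic_res_limit:
  fixes y :: "'a::complex_banach_algebra"
  assumes inv: "\<And>z. cmod z = 1 \<Longrightarrow> 1 - of_complex z * y \<in> invertibles"
  obtains p where "(\<lambda>k. dyadic_res y k 1) \<longlonglongrightarrow> p" "p * p = p"
proof -
  obtain L where L: "0 \<le> L"
    "\<And>k z w. cmod z = 1 \<Longrightarrow> cmod w = 1 \<Longrightarrow>
      norm (dyadic_res y k z - dyadic_res y k w) \<le> L * (1 / sqrt 2) ^ k * cmod (z - w)"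
    using dyadic_res_lipschitz[OF inv] by blast
  define r where "r = 1 / sqrt 2"
  have r: "0 \<le> r" "r < 1" by (auto simp: r_def)
  have L': "norm (dyadic_res y k (- 1) - dyadic_res y k 1) \<le> 2 * L * r ^ k" for k
    using L(2)[of "- 1" 1 k] by (simp add: r_def)
  have sq: "dyadic_res y (Suc k) 1 = (1/2) *\<^sub>R (dyadic_res y k 1 + dyadic_res y k (- 1))"
    "dyadic_res y (Suc k) 1 = dyadic_res y k 1 * dyadic_res y k (- 1)" for k
    using dyadic_res_square[of 1 y k] dyadic_invertible[of y 1 k] dyadic_invertible[of y "- 1" k] inv
    by simp_all
  have "dyadic_res y (Suc k) 1 - dyadic_res y k 1 =
      (1/2) *\<^sub>R (dyadic_res y k (- 1) - dyadic_res y k 1)" for k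
    unfolding sq(1) by (simp add: algebra_simps flip: scaleR_add_left)
  then have le: "norm (dyadic_res y (Suc k) 1 - dyadic_res y k 1) \<le> L * r ^ k" for k
    using L'[of k] by simp
  have "summable (\<lambda>k. L * r ^ k)"
    using r by (intro summable_mult summable_geometric) auto
  then have "summable (\<lambda>k. dyadic_res y (Suc k) 1 - dyadic_res y k 1)"
    by (rule summable_comparison_test') (rule le)
  then have "convergent (\<lambda>n. \<Sum>k<n. dyadic_res y (Suc k) 1 - dyadic_res y k 1)"
    by (simp add: summable_iff_convergent)
  then obtain l where "(\<lambda>n. dyadic_res y n 1 - dyadic_res y 0 1) \<longlonglongrightarrow> l"
    using sum_lessThan_telescope[of "\<lambda>k. dyadic_res y k 1"] by (auto simp: convergent_def)
  from tendsto_add[OF this tendsto_const[of "dyadic_res y 0 1"]]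
  obtain p where p: "(\<lambda>n. dyadic_res y n 1) \<longlonglongrightarrow> p" by auto
  have lim0: "(\<lambda>k. 2 * L * r ^ k) \<longlonglongrightarrow> 0"
    using r by (intro tendsto_mult_right_zero LIMSEQ_realpow_zero)
  have "(\<lambda>k. dyadic_res y k (- 1) - dyadic_res y k 1) \<longlonglongrightarrow> 0"
    by (rule Lim_null_comparison[OF always_eventually lim0]) (rule allI, rule L')
  from tendsto_add[OF this p] have "(\<lambda>k. dyadic_res y k (- 1)) \<longlonglongrightarrow> p" by simp
  from tendsto_mult[OF p this] have "(\<lambda>k. dyadic_res y (Suc k) 1) \<longlonglongrightarrow> p * p"
    unfolding sq(2) .
  then have "p * p = p"
    using LIMSEQ_Suc[OF p] LIMSEQ_unique by blast
  with p that show thesis by blast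
qed

text \<open>Each dyadic step averages over the two square roots on the circle, which preserves a
  uniform bound on the difference.\<close>

lemma dyadic_res_diff_le:
  fixes x y :: "'a::complex_banach_algebra"
  assumes inv: "\<And>z. cmod z = 1 \<Longrightarrow> 1 - of_complex z * x \<in> invertibles"
    "\<And>z. cmod z = 1 \<Longrightarrow> 1 - of_complex z * y \<in> invertibles"
    and D: "\<And>z. cmod z = 1 \<Longrightarrow> norm (dyadic_res x 0 z - dyadic_res y 0 z) \<le> D"
    and z: "cmod z = 1"
  shows "norm (dyadic_res x k z - dyadic_res y k z) \<le> D"
  using z
proof (induction k arbitrary: z)
  case 0
  then show ?case by (rule D)
next
  case (Suc k)
  define s where "s = csqrt z"
  have s: "z = s\<^sup>2" "cmod s = 1"
    using Suc.prems by (simp_all add: s_def norm_csqrt)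
  define E where "E = (\<lambda>z. dyadic_res x k z - dyadic_res y k z)"
  have "dyadic_res x (Suc k) z - dyadic_res y (Suc k) z = (1/2) *\<^sub>R (E s + E (- s))"
    using s by (simp add: dyadic_res_square dyadic_invertible inv E_def algebra_simps)
  also have "norm \<dots> \<le> (1/2) * (norm (E s) + norm (E (- s)))"
    using norm_triangle_ineq by simp
  also have "\<dots> \<le> (1/2) * (D + D)"
    unfolding E_def using s by (intro mult_left_mono add_mono Suc.IH) auto
  finally show ?case by simp
qed

lemma idempotent_norm_less_1:
  fixes e :: "'a::real_normed_algebra"
  assumes "e * e = e" "norm e < 1" shows "e = 0"
proof (rule ccontr)
  assume "e \<noteq> 0"
  then have "norm e * norm e < 1 * norm e"
    using assms by (intro mult_strict_right_mono) auto
  then show False using norm_mult_ineq[of e e] assms by simp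
qed

text \<open>A replacement for the spectral radius formula: the idempotents obtained from the radii
  \<open>s \<in> [0, 1]\<close> depend on \<open>s\<close> in a Lipschitz way, hence are all equal to the one for \<open>s = 0\<close>.\<close>
lemma dyadic_powers_tendsto_0:
  fixes v :: "'a::complex_banach_algebra"
  assumes inv: "\<And>z. cmod z \<le> 1 \<Longrightarrow> 1 - of_complex z * v \<in> invertibles"
  shows "(\<lambda>k. v ^ 2 ^ k) \<longlonglongrightarrow> 0"
proof -
  define V where "V = (\<lambda>s::real. s *\<^sub>R v)"
  have V: "of_complex z * V s = of_complex (z * of_real s) * v" for z s
    by (simp add: V_def of_complex_mult of_complex_of_real)
  have inv_V: "1 - of_complex z * V s \<in> invertibles" if "s \<in> {0..1}" "cmod z = 1" for s z
    unfolding V using that by (intro inv) (auto simp: norm_mult)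
  obtain M where M: "0 \<le> M" "\<And>z. cmod z \<le> 1 \<Longrightarrow> norm (invel (1 - of_complex z * v)) \<le> M"
    using bounded_invel_on_compact[of "cball 0 1" v] inv by (auto simp: dist_norm)
  define L where "L = M * norm v * M"
  have L: "norm (dyadic_res (V s) k 1 - dyadic_res (V t) k 1) \<le> L * \<bar>s - t\<bar>"
    if "s \<in> {0..1}" "t \<in> {0..1}" for s t k
  proof (rule dyadic_res_diff_le)
    fix z assume z: "cmod z = 1"
    have "dyadic_res (V s) 0 z - dyadic_res (V t) 0 z =
        dyadic_res (V s) 0 z * (of_complex (z * of_real (s - t)) * v) * dyadic_res (V t) 0 z"
      using z that inv_V
      by (simp add: dyadic_res_def invel_diff V of_complex_diff algebra_simps del: of_real_mult)
    also have "norm \<dots> \<le> norm (dyadic_res (V s) 0 z) * norm (of_complex (z * of_real (s - t)) * v) * norm (dyadic_res (V t) 0 z)"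
      by (intro order_trans[OF norm_mult_ineq] mult_right_mono) (auto simp: norm_mult_ineq)
    also have "\<dots> \<le> M * norm (of_complex (z * of_real (s - t)) * v) * M"
      using M z that by (intro mult_mono) (auto simp: dyadic_res_def V norm_mult)
    also have "\<dots> = L * \<bar>s - t\<bar>"
      using z by (simp add: L_def norm_of_complex_mult norm_mult del: of_real_diff)
    finally show "norm (dyadic_res (V s) 0 z - dyadic_res (V t) 0 z) \<le> L * \<bar>s - t\<bar>" .
  qed (use that inv_V in auto)
  have "\<exists>p. (\<lambda>k. dyadic_res (V s) k 1) \<longlonglongrightarrow> p \<and> p * p = p" if "s \<in> {0..1}" for s
    using dyadic_res_limit[of "V s"] inv_V[OF that] by metis
  then obtain p where p: "\<And>s. s \<in> {0..1} \<Longrightarrow> (\<lambda>k. dyadic_res (V s) k 1) \<longlonglongrightarrow> p s"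
    and pp: "\<And>s. s \<in> {0..1} \<Longrightarrow> p s * p s = p s"
    by metis
  have Lp: "norm (p s - p t) \<le> L * \<bar>s - t\<bar>" if "s \<in> {0..1}" "t \<in> {0..1}" for s t
    by (rule Lim_bounded[OF tendsto_norm[OF tendsto_diff[OF p[OF that(1)] p[OF that(2)]]], of 0])
      (use L[OF that] in auto)
  \<comment> \<open>With N > L, a step from i / N to (i + 1) / N moves the idempotent by less than 1
    in norm. Once it is 1 it stays 1, since an idempotent of norm below 1 vanishes.\<close>
  obtain N :: nat where N: "L < N" "0 < N"
    using reals_Archimedean2[of "max L 0"] by auto
  have "p (real i / real N) = 1" if "i \<le> N" for i
    using that
  proof (induction i)
    case 0
    have "(\<lambda>k. dyadic_res (V 0) k 1) \<longlonglongrightarrow> 1"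
      by (simp add: dyadic_res_def V_def power_0_left)
    then show ?case using p[of 0] LIMSEQ_unique by auto
  next
    case (Suc i)
    have s: "real i / real N \<in> {0..1}" and t: "real (Suc i) / real N \<in> {0..1}"
      using Suc.prems N by auto
    have "norm (1 - p (real (Suc i) / real N)) \<le> L * \<bar>real i / real N - real (Suc i) / real N\<bar>"
      using Lp[OF s t] Suc by simp
    also have "\<bar>real i / real N - real (Suc i) / real N\<bar> = 1 / real N"
      by (simp add: diff_divide_distrib[symmetric])
    also have "L * (1 / real N) < 1" using N by simp
    finally have "1 - p (real (Suc i) / real N) = 0"
      using pp[OF t] by (intro idempotent_norm_less_1) (simp_all add: algebra_simps)
    then show ?case by simp
  qed
  from this[of N] have "p 1 = 1" using N by simp
  with p[of 1] have lim: "(\<lambda>k. dyadic_res v k 1) \<longlonglongrightarrow> 1"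
    by (simp add: V_def)
  have "invel (dyadic_res v k 1) = 1 - v ^ 2 ^ k" for k
    using dyadic_invertible[of v 1 k] inv by (simp add: dyadic_res_def invel_invel)
  with tendsto_invel[OF lim] have "(\<lambda>k. 1 - v ^ 2 ^ k) \<longlonglongrightarrow> 1" by simp
  from tendsto_diff[OF tendsto_const this, of 1] show ?thesis by simp
qed

section \<open>Riesz idempotents\<close>

text \<open>On the corner of q, y has an inverse v whose spectrum lies in the open unit disc, so the
  dyadic powers of v tend to 0. From v^n y^n = q and the resolvent equation, v^n = v^n F - q F with
  F = \<open>dyadic_res y k 1\<close> and n = 2^k; the limit is 0 = - q p.\<close>

lemma dyadic_limit_annihilated:
  fixes y :: "'a::complex_banach_algebra"
  assumes inv: "\<And>z. cmod z = 1 \<Longrightarrow> 1 - of_complex z * y \<in> invertibles"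
    and lim: "(\<lambda>k. dyadic_res y k 1) \<longlonglongrightarrow> p"
    and q: "q * q = q" "q * y = y * q"
    and cinv: "\<And>\<zeta>. cmod \<zeta> \<le> 1 \<Longrightarrow> \<exists>w. corner_inv q (of_complex \<zeta> - y) w"
  shows "q * p = 0"
proof -
  obtain w0 where "corner_inv q (of_complex 0 - y) w0" using cinv[of 0] by auto
  then have w0: "q * w0 = w0" "w0 * q = w0" "- (w0 * y * q) = q" "- (q * y * w0) = q"
    by (simp_all add: corner_inv_def)
  define v where "v = - w0"
  have qv: "q * v = v" "v * q = v" using w0 by (simp_all add: v_def)
  have vy: "v * y = q" "y * v = q"
    using w0 q by (simp_all add: v_def) (metis mult.assoc)+
  have "1 - of_complex z * v \<in> invertibles" if z: "cmod z \<le> 1" for z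
  proof -
    obtain w where "corner_inv q (of_complex z - y) w" using cinv z by auto
    then have w: "q * w = w" "w * q = w" "w * (of_complex z - y) * q = q" "q * (of_complex z - y) * w = q"
      by (simp_all add: corner_inv_def)
    define Z :: 'a where "Z = of_complex z"
    have Z: "x * Z = Z * x" for x by (simp add: Z_def of_complex_commute)
    have l: "w * y = Z * w - q"
    proof -
      have "w * (Z - y) * q = w * Z * q - w * (y * q)" by (simp add: algebra_simps)
      also have "\<dots> = Z * w - w * y"
        using w q by (metis Z mult.assoc)
      finally show ?thesis using w(3) by (simp add: Z_def algebra_simps)
    qed
    have r: "y * w = Z * w - q"
    proof -
      have "q * (Z - y) * w = Z * (q * w) - y * (q * w)"
        using q by (simp add: algebra_simps Z flip: mult.assoc)
      also have "\<dots> = Z * w - y * w" using w by simp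
      finally show ?thesis using w(4) by (simp add: Z_def algebra_simps)
    qed
    have vw: "v * w = w * v"
    proof -
      have "w * y = y * w" using l r by simp
      have "v * w = v * (q * w)" using w by simp
      also have "\<dots> = v * ((w * y) * v)" by (metis mult.assoc vy(2) w(1,2))
      also have "\<dots> = v * y * w * v" using \<open>w * y = y * w\<close> by (simp add: mult.assoc)
      also have "\<dots> = w * v" using vy w by simp
      finally show ?thesis .
    qed
    have "v * (w * y) = w" using vw vy w by (metis mult.assoc)
    then have k: "Z * (v * w) = v + w" unfolding l using qv
      by (simp add: right_diff_distrib) (metis Z mult.assoc add.commute diff_eq_eq)
    \<comment> \<open>On the corner, where v inverts y and w inverts z - y, \<open>1 - Z * w\<close>
      is - y (z - y)^-1, that is, the inverse of 1 - z v; on the complement both are the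
      identity.\<close>
    define X where "X = 1 - Z * w"
    have "(1 - Z * v) * X = 1" "X * (1 - Z * v) = 1"
    proof -
      have "(1 - Z * v) * X = 1 - Z * v - Z * w + Z * (Z * (v * w))"
        unfolding X_def by (simp add: algebra_simps) (metis Z mult.assoc)
      then show "(1 - Z * v) * X = 1" unfolding k by (simp add: algebra_simps)
      have "X * (1 - Z * v) = 1 - Z * v - Z * w + Z * (Z * (w * v))"
        unfolding X_def by (simp add: algebra_simps) (metis Z mult.assoc)
      then show "X * (1 - Z * v) = 1" unfolding vw[symmetric] k by (simp add: algebra_simps)
    qed
    then show ?thesis unfolding Z_def by (rule invertiblesI)
  qed
  then have v0: "(\<lambda>k. v ^ 2 ^ k) \<longlonglongrightarrow> 0" by (rule dyadic_powers_tendsto_0)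
  \<comment> \<open>Only positive exponents are covered, because exponent 0 would give 1 instead of
    q.\<close>
  have "v ^ Suc n * y ^ Suc n = q" for n
  proof (induction n)
    case 0
    then show ?case using vy by simp
  next
    case (Suc n)
    have "v ^ Suc (Suc n) * y ^ Suc (Suc n) = v * (v ^ Suc n * y ^ Suc n) * y"
      by (metis mult.assoc power_Suc power_Suc2)
    then show ?case using Suc qv vy by simp
  qed
  from this[of "2 ^ k - 1" for k] have vny: "v ^ 2 ^ k * y ^ 2 ^ k = q" for k by simp
  have "v ^ 2 ^ k = v ^ 2 ^ k * dyadic_res y k 1 - q * dyadic_res y k 1" for k
  proof -
    have "v ^ 2 ^ k = v ^ 2 ^ k * ((1 - y ^ 2 ^ k) * dyadic_res y k 1)"
      using dyadic_invertible[of y 1 k] inv by (simp add: dyadic_res_def invel_right)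
    then show ?thesis by (simp add: left_diff_distrib right_diff_distrib vny flip: mult.assoc)
  qed
  moreover have "(\<lambda>k. v ^ 2 ^ k * dyadic_res y k 1 - q * dyadic_res y k 1) \<longlonglongrightarrow> 0 * p - q * p"
    by (intro tendsto_intros v0 lim)
  ultimately have "(\<lambda>k. v ^ 2 ^ k) \<longlonglongrightarrow> 0 * p - q * p" by simp
  from LIMSEQ_unique[OF this v0] show ?thesis by simp
qed

text \<open>Scale a to an element y of norm below 1, so that the idempotent for the unit circle is
  1. An empty spectrum would let it be annihilated by q = 1.\<close>

theorem spectrum_nonempty: "spectrum a \<noteq> {}"
proof
  assume "spectrum a = {}"
  then have a: "of_complex \<mu> - a \<in> invertibles" for \<mu>
    using spectrum_iff by blast
  define R where "R = 2 * norm a + 1"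
  have R: "R > 0" by (simp add: R_def add_nonneg_pos)
  define y where "y = of_complex (of_real (1 / R)) * a"
  have ny: "norm y < 1"
    using R by (simp add: y_def norm_of_complex_mult norm_divide) (simp add: R_def field_simps)
  have inv: "1 - of_complex z * y \<in> invertibles" if "cmod z = 1" for z
    using ny that by (intro Neumann_invertible) (simp add: norm_of_complex_mult)
  have eq: "of_complex \<zeta> - y = of_complex (of_real (1 / R)) * (of_complex (of_real R * \<zeta>) - a)" for \<zeta>
    using R by (simp add: y_def right_diff_distrib flip: of_complex_mult)
  have "(\<lambda>k. y ^ 2 ^ k) \<longlonglongrightarrow> 0"
    using ny by (intro dyadic_powers_tendsto_0 Neumann_invertible)
      (auto simp: norm_of_complex_mult intro: le_less_trans[OF mult_left_le_one_le])
  then have "(\<lambda>k. 1 - y ^ 2 ^ k) \<longlonglongrightarrow> 1 - 0" by (intro tendsto_intros)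
  then have "(\<lambda>k. invel (1 - y ^ 2 ^ k)) \<longlonglongrightarrow> invel 1" by (intro tendsto_invel) simp_all
  then have lim: "(\<lambda>k. dyadic_res y k 1) \<longlonglongrightarrow> 1" by (simp add: dyadic_res_def)
  have "1 * 1 = (0::'a)"
  proof (rule dyadic_limit_annihilated[where y = y])
    fix \<zeta>
    have "of_complex \<zeta> - y \<in> invertibles"
      unfolding eq using R by (intro invertibles_mult invertibles_of_complex a) auto
    then show "\<exists>w. corner_inv 1 (of_complex \<zeta> - y) w"
      using corner_inv_of_invertible[of _ 1] by auto
  qed (use inv lim in auto)
  then show False by simp
qed

text \<open>Multiplying the factor of \<mu>^n - y^n by the resolvent gives approximate inverses
  \<open>G k\<close> of \<mu> - y with product \<mu>^n F - (F - 1), for n = 2^k. This tends to 1 - p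
  if \<bar>\<mu>\<bar> < 1, and after division by \<mu>^n to p if \<bar>\<mu>\<bar> > 1.\<close>

lemma dyadic_limit_splits:
  fixes y :: "'a::complex_banach_algebra"
  assumes inv: "\<And>z. cmod z = 1 \<Longrightarrow> 1 - of_complex z * y \<in> invertibles"
    and lim: "(\<lambda>k. dyadic_res y k 1) \<longlonglongrightarrow> p" and pp: "p * p = p"
  shows "x * y = y * x \<Longrightarrow> x * p = p * x"
    and "cmod \<mu> > 1 \<Longrightarrow> \<exists>w. corner_inv p (of_complex \<mu> - y) w"
    and "cmod \<mu> < 1 \<Longrightarrow> \<exists>w. corner_inv (1 - p) (of_complex \<mu> - y) w"
proof -
  have inv': "1 - y ^ 2 ^ k \<in> invertibles" for k
    using dyadic_invertible[of y 1 k] inv by simp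
  have comm: "dyadic_res y k 1 * x = x * dyadic_res y k 1" if "x * y = y * x" for x k
    using inv' power_commuting_commutes[OF that[symmetric]]
    by (auto simp: dyadic_res_def algebra_simps intro!: invel_commute)
  have comm_p: "x * p = p * x" if "x * y = y * x" for x
  proof -
    have "(\<lambda>k. dyadic_res y k 1 * x) \<longlonglongrightarrow> p * x" "(\<lambda>k. x * dyadic_res y k 1) \<longlonglongrightarrow> x * p"
      by (intro tendsto_intros lim)+
    with comm[OF that] show ?thesis using LIMSEQ_unique by fastforce
  qed
  then show "x * y = y * x \<Longrightarrow> x * p = p * x" .
  have py: "p * (of_complex \<mu> - y) = (of_complex \<mu> - y) * p"
    using comm_p[of y] by (simp add: algebra_simps of_complex_commute)
  have res: "y ^ 2 ^ k * dyadic_res y k 1 = dyadic_res y k 1 - 1" for k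
    using invel_right[OF inv'[of k]] by (simp add: dyadic_res_def algebra_simps)
  have "\<forall>k. \<exists>g. (of_complex \<mu> - y) * g = of_complex (\<mu> ^ 2 ^ k) - y ^ 2 ^ k
      \<and> g * (of_complex \<mu> - y) = of_complex (\<mu> ^ 2 ^ k) - y ^ 2 ^ k"
    using geometric_factor by blast
  then obtain g where g: "\<And>k. (of_complex \<mu> - y) * g k = of_complex (\<mu> ^ 2 ^ k) - y ^ 2 ^ k"
      "\<And>k. g k * (of_complex \<mu> - y) = of_complex (\<mu> ^ 2 ^ k) - y ^ 2 ^ k"
    by metis
  define G where "G = (\<lambda>k. g k * dyadic_res y k 1)"
  have G: "(of_complex \<mu> - y) * G k = of_complex (\<mu> ^ 2 ^ k) * dyadic_res y k 1 - (dyadic_res y k 1 - 1)" for k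
  proof -
    have "(of_complex \<mu> - y) * G k = (of_complex \<mu> - y) * g k * dyadic_res y k 1"
      by (simp add: G_def mult.assoc)
    then show ?thesis unfolding g by (simp add: left_diff_distrib res)
  qed
  have G': "(of_complex \<mu> - y) * G k = G k * (of_complex \<mu> - y)" for k
  proof -
    have "G k * (of_complex \<mu> - y) = (g k * (of_complex \<mu> - y)) * dyadic_res y k 1"
      using comm[of "of_complex \<mu> - y" k]
      by (simp add: G_def mult.assoc) (simp add: algebra_simps of_complex_commute)
    then show ?thesis by (simp add: G_def g flip: mult.assoc)
  qed
  show "\<exists>w. corner_inv p (of_complex \<mu> - y) w" if \<mu>: "cmod \<mu> > 1"
  proof (rule corner_inv_approx)
    define i where "i = (\<lambda>k::nat. of_complex ((inverse \<mu>) ^ 2 ^ k) :: 'a)"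
    have "(\<lambda>n. inverse \<mu> ^ n) \<longlonglongrightarrow> 0"
      using \<mu> by (intro LIMSEQ_power_zero) (simp add: norm_inverse inverse_less_1_iff)
    from LIMSEQ_subseq_LIMSEQ[OF this, of "\<lambda>k. 2 ^ k"]
    have "(\<lambda>k. inverse \<mu> ^ 2 ^ k) \<longlonglongrightarrow> 0" by (simp add: o_def strict_mono_def)
    then have "i \<longlonglongrightarrow> of_complex 0" unfolding i_def by (intro tendsto_intros)
    then have i0: "i \<longlonglongrightarrow> 0" by simp
    have ic: "x * i k = i k * x" for x k by (simp add: i_def of_complex_commute)
    have i1: "i k * of_complex (\<mu> ^ 2 ^ k) = 1" for k
    proof -
      have "inverse \<mu> ^ 2 ^ k * \<mu> ^ 2 ^ k = (inverse \<mu> * \<mu>) ^ 2 ^ k"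
        by (simp only: power_mult_distrib)
      also have "inverse \<mu> * \<mu> = 1" using \<mu> by (intro left_inverse) auto
      finally show ?thesis by (simp add: i_def flip: of_complex_mult)
    qed
    show "(of_complex \<mu> - y) * (i k * G k) = i k * G k * (of_complex \<mu> - y)" for k
      by (metis G' ic mult.assoc)
    have "(of_complex \<mu> - y) * (i k * G k) = i k * ((of_complex \<mu> - y) * G k)" for k
      by (metis ic mult.assoc)
    also have "\<dots> k = dyadic_res y k 1 - i k * (dyadic_res y k 1 - 1)" for k
      unfolding G by (simp add: right_diff_distrib i1 flip: mult.assoc)
    finally have "(\<lambda>k. (of_complex \<mu> - y) * (i k * G k)) = (\<lambda>k. dyadic_res y k 1 - i k * (dyadic_res y k 1 - 1))"
      by blast
    moreover have "(\<lambda>k. dyadic_res y k 1 - i k * (dyadic_res y k 1 - 1)) \<longlonglongrightarrow> p - 0 * (p - 1)"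
      by (intro tendsto_intros i0 lim)
    ultimately show "(\<lambda>k. (of_complex \<mu> - y) * (i k * G k)) \<longlonglongrightarrow> p" by simp
  qed (use pp py in auto)
  show "\<exists>w. corner_inv (1 - p) (of_complex \<mu> - y) w" if \<mu>: "cmod \<mu> < 1"
  proof (rule corner_inv_approx)
    have "(\<lambda>n. \<mu> ^ n) \<longlonglongrightarrow> 0"
      using \<mu> by (rule LIMSEQ_power_zero)
    from LIMSEQ_subseq_LIMSEQ[OF this, of "\<lambda>k. 2 ^ k"]
    have "(\<lambda>k. \<mu> ^ 2 ^ k) \<longlonglongrightarrow> 0" by (simp add: o_def strict_mono_def)
    then have "(\<lambda>k. of_complex (\<mu> ^ 2 ^ k) * dyadic_res y k 1 - (dyadic_res y k 1 - 1)) \<longlonglongrightarrow> of_complex 0 * p - (p - 1)"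
      by (intro tendsto_intros lim)
    then show "(\<lambda>k. (of_complex \<mu> - y) * G k) \<longlonglongrightarrow> 1 - p" by (simp add: G)
    show "(1 - p) * (of_complex \<mu> - y) = (of_complex \<mu> - y) * (1 - p)"
      using py by (simp add: algebra_simps)
    show "(1 - p) * (1 - p) = 1 - p" by (simp add: algebra_simps pp)
  qed (fact G')
qed

text \<open>The clause \<open>q * p = 0\<close> replaces the uniqueness of Riesz idempotents: \<open>p\<close> vanishes on every
  corner in which \<open>a\<close> has no spectrum near \<open>\<nu>\<close>.\<close>
lemma riesz_idempotent:
  fixes a :: "'a::complex_banach_algebra" and T :: "'a \<Rightarrow> 'b::complex_banach_algebra"
  assumes \<rho>: "\<rho> > 0" and iso: "\<And>z. 0 < cmod (z - \<nu>) \<Longrightarrow> cmod (z - \<nu>) \<le> \<rho> \<Longrightarrow> z \<notin> spectrum a"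
    and T: "unital_hom T" "bounded_linear T" "\<nu> \<notin> spectrum (T a)"
  obtains p where "p * p = p" "\<And>x. x * a = a * x \<Longrightarrow> x * p = p * x"
    "\<And>\<zeta>. \<zeta> \<noteq> \<nu> \<Longrightarrow> \<exists>w. corner_inv p (of_complex \<zeta> - a) w"
    "\<exists>w. corner_inv (1 - p) (of_complex \<nu> - a) w"
    "\<And>q. q * q = q \<Longrightarrow> q * a = a * q \<Longrightarrow>
      (\<And>\<zeta>. cmod (\<zeta> - \<nu>) \<le> \<rho> \<Longrightarrow> \<exists>w. corner_inv q (of_complex \<zeta> - a) w) \<Longrightarrow> q * p = 0"
    "T p = 0"
proof -
  \<comment> \<open>The affine map z \<mapsto> r (z - \<nu>) carries the closed disc of radius
    \<rho> about \<nu> onto the closed unit disc.\<close>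
  define r :: complex where "r = of_real (1 / \<rho>)"
  have r: "r \<noteq> 0" "cmod r = 1 / \<rho>" using \<rho> by (simp_all add: r_def norm_divide)
  define y where "y = of_complex r * (a - of_complex \<nu>)"
  have y_eq: "of_complex \<mu> - y = of_complex r * (of_complex (\<nu> + \<mu> / r) - a)" for \<mu>
    using r by (simp add: y_def algebra_simps of_complex_add flip: of_complex_mult)
  have a_eq: "of_complex \<zeta> - a = of_complex (inverse r) * (of_complex (r * (\<zeta> - \<nu>)) - y)" for \<zeta>
    unfolding y_eq using r by (simp add: of_complex_mult_inverse)
  have inv_iff: "1 - of_complex z * y \<in> invertibles" if "cmod z = 1" for z
  proof -
    have "1 - of_complex z * y = of_complex z * (of_complex (inverse z) - y)"
    proof -
      have "z * inverse z = 1" using that by (intro right_inverse) auto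
      then show ?thesis by (simp add: right_diff_distrib flip: of_complex_mult)
    qed
    also have "\<dots> \<in> invertibles"
    proof (intro invertibles_mult invertibles_of_complex)
      have "cmod (inverse z / r) = \<rho>" using that r \<rho> by (simp add: norm_divide norm_inverse)
      then have "\<nu> + inverse z / r \<notin> spectrum a" using \<rho> by (intro iso) auto
      then show "of_complex (inverse z) - y \<in> invertibles"
        unfolding y_eq using r by (intro invertibles_mult invertibles_of_complex) (auto simp: spectrum_iff)
    qed (use that in auto)
    finally show ?thesis .
  qed
  obtain p where p: "(\<lambda>k. dyadic_res y k 1) \<longlonglongrightarrow> p" "p * p = p"
    using dyadic_res_limit[OF inv_iff] by blast
  note split = dyadic_limit_splits[OF inv_iff p]
  have ya: "x * y = y * x" if "x * a = a * x" for x
  proof -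
    have "x * (a - of_complex \<nu>) = (a - of_complex \<nu>) * x"
      using that by (simp add: algebra_simps of_complex_commute)
    then show ?thesis by (simp add: y_def of_complex_left_commute[of x] mult.assoc)
  qed
  show thesis
  proof (rule that[of p])
    show "x * p = p * x" if "x * a = a * x" for x
      using ya[OF that] split(1) by blast
    \<comment> \<open>Inside the disc \<zeta> is off the spectrum of a; outside it the splitting at
      the circle applies.\<close>
    show "\<exists>w. corner_inv p (of_complex \<zeta> - a) w" if "\<zeta> \<noteq> \<nu>" for \<zeta>
    proof (cases "cmod (\<zeta> - \<nu>) \<le> \<rho>")
      case True
      then have "of_complex \<zeta> - a \<in> invertibles" using iso[of \<zeta>] that by (simp add: spectrum_iff)
      moreover have "p * (of_complex \<zeta> - a) = (of_complex \<zeta> - a) * p"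
        using split(1)[of a] ya[of a] by (simp add: algebra_simps of_complex_commute)
      ultimately show ?thesis using corner_inv_of_invertible p by blast
    next
      case False
      then have "cmod (r * (\<zeta> - \<nu>)) > 1" using r \<rho> unfolding norm_mult r(2) by simp
      then show ?thesis unfolding a_eq using corner_inv_scale split(2) r by (meson nonzero_imp_inverse_nonzero)
    qed
    have "cmod (r * (\<nu> - \<nu>)) < 1" by simp
    then show "\<exists>w. corner_inv (1 - p) (of_complex \<nu> - a) w"
      unfolding a_eq[of \<nu>] using corner_inv_scale split(3) r by (meson nonzero_imp_inverse_nonzero)
    have small: "cmod (\<nu> + \<zeta> / r - \<nu>) \<le> \<rho>" if "cmod \<zeta> \<le> 1" for \<zeta>
      using that r \<rho> by (simp add: norm_divide field_simps)
    show "q * p = 0" if q: "q * q = q" "q * a = a * q"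
      "\<And>\<zeta>. cmod (\<zeta> - \<nu>) \<le> \<rho> \<Longrightarrow> \<exists>w. corner_inv q (of_complex \<zeta> - a) w" for q
    proof (rule dyadic_limit_annihilated[where y = y])
      show "q * y = y * q" by (rule ya[OF q(2)])
      show "\<exists>w. corner_inv q (of_complex \<zeta> - y) w" if "cmod \<zeta> \<le> 1" for \<zeta>
        unfolding y_eq using q(3)[OF small[OF that]] corner_inv_scale r by blast
    qed (use inv_iff p q in auto)
    have Ty: "of_complex \<mu> - T y = of_complex r * (of_complex (\<nu> + \<mu> / r) - T a)" for \<mu>
      using arg_cong[OF y_eq[of \<mu>], of T] T(1)
      by (simp add: unital_hom_diff unital_hom_mult unital_hom_of_complex)
    have T_res: "T (1 - of_complex z * y ^ n) = 1 - of_complex z * T y ^ n" for z n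
      using T(1) by (simp add: unital_hom_diff unital_hom_mult unital_hom_of_complex unital_hom_power unital_hom_1)
    have T_inv: "1 - of_complex z * T y \<in> invertibles" if "cmod z = 1" for z
      using unital_hom_invel(1)[OF T(1) inv_iff[OF that]] T_res[of z 1] by simp
    have "T (dyadic_res y k 1) = dyadic_res (T y) k 1" for k
      using unital_hom_invel(2)[OF T(1) dyadic_invertible[OF inv_iff, of 1 k]] T_res[of 1]
      by (simp add: dyadic_res_def)
    with bounded_linear.tendsto[OF T(2) p(1)]
    have "(\<lambda>k. dyadic_res (T y) k 1) \<longlonglongrightarrow> T p" by simp
    note T_lim = this
    \<comment> \<open>\<open>T p\<close> is the idempotent of \<open>T a\<close> for the same
      circle, and \<open>T a\<close> has no spectrum in the disc, not even at \<nu>. So it is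
      annihilated by q = 1.\<close>
    have "1 * T p = 0"
    proof (rule dyadic_limit_annihilated[where y = "T y"])
      fix \<zeta> assume "cmod \<zeta> \<le> 1"
      then have "\<nu> + \<zeta> / r \<notin> spectrum (T a)"
        using iso[of "\<nu> + \<zeta> / r"] small[of \<zeta>] T(3) spectrum_unital_hom[OF T(1)]
        by (cases "\<zeta> = 0") (auto simp: r)
      then have "of_complex \<zeta> - T y \<in> invertibles"
        unfolding Ty using r by (intro invertibles_mult invertibles_of_complex) (auto simp: spectrum_iff)
      then show "\<exists>w. corner_inv 1 (of_complex \<zeta> - T y) w"
        using corner_inv_of_invertible[of _ 1] by auto
    qed (use T_inv T_lim in auto)
    then show "T p = 0" by simp
  qed (fact p(2))
qed

section \<open>Browder elements\<close>

text \<open>The Riesz property read as invertibility on a punctured neighbourhood; points off the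
  spectrum are covered because the spectrum is closed.\<close>

lemma isolated_from_nonzero:
  assumes "riesz_property T" "T x = 0" "\<mu> \<noteq> 0"
  shows "\<forall>\<^sub>F z in at \<mu>. of_complex z - x \<in> invertibles"
proof (cases "\<mu> \<in> spectrum x")
  case True
  then have "\<mu> \<in> isolated_points_of (spectrum x)"
    using assms by (auto simp: riesz_property_def null_space_def acc_def)
  then show ?thesis
    by (simp add: isolated_points_of_def spectrum_iff)
next
  case False
  then have "\<forall>\<^sub>F z in at \<mu>. z \<in> - spectrum x"
    using closed_spectrum[of x] by (intro eventually_at_in_open') auto
  then show ?thesis by (simp add: spectrum_iff)
qed

text \<open>Since p commutes with everything involved, the inverse can be glued as y^-1 p + z^-1 (1
  - p).\<close>

lemma idempotent_sum_invertible:
  assumes p: "p * p = p" "p * x = x * p" "p * y = y * p" "p * z = z * p"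
    and eq: "x * p = y * p" "x * (1 - p) = z * (1 - p)"
    and inv: "y \<in> invertibles" "z \<in> invertibles"
  shows "x \<in> invertibles"
proof -
  have x: "x = y * p + z * (1 - p)" using eq by (simp add: algebra_simps)
  define u v where "u = invel y" and "v = invel z"
  have c: "u * p = p * u" "v * p = p * v"
    using p inv by (simp_all add: u_def v_def invel_commute)
  have yu: "y * u = 1" "u * y = 1" "z * v = 1" "v * z = 1"
    using inv by (simp_all add: u_def v_def invel_left invel_right)
  define q where "q = 1 - p"
  have q: "q * q = q" "p * q = 0" "q * p = 0" "q * z = z * q" "v * q = q * v" "p + q = 1" "q * u = u * q" "q * y = y * q"
    using p c by (simp_all add: q_def algebra_simps)
  have x': "x = y * p + z * q" using x by (simp add: q_def)
  have a: "(y * p) * (u * p) = p" "(u * p) * (y * p) = p" "(z * q) * (v * q) = q" "(v * q) * (z * q) = q"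
    "(y * p) * (v * q) = 0" "(u * p) * (z * q) = 0" "(z * q) * (u * p) = 0" "(v * q) * (y * p) = 0"
    using p q c yu by (metis mult.assoc mult_1_left mult_1_right mult_zero_left mult_zero_right)+
  have "x * (u * p + v * q) = 1" "(u * p + v * q) * x = 1"
    unfolding x' by (simp_all add: distrib_left distrib_right a q(6))
  then show ?thesis by (rule invertiblesI)
qed

text \<open>With \<open>k = v\<^sup>-\<^sup>1 u\<close>, the sum \<open>u + v = v (1 + k)\<close> can fail to be invertible only because of the
  Riesz idempotent \<open>p\<close> of \<open>k\<close> at \<open>-1\<close>, and \<open>p (u + v)\<close> lies in the kernel of \<open>T\<close>.\<close>
lemma browder_elem_isolated:
  fixes T :: "'a::complex_banach_algebra \<Rightarrow> 'b::complex_banach_algebra"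
  assumes T: "unital_hom T" "bounded_linear T" "riesz_property T" and b: "b \<in> browder_elems T"
  shows "\<forall>\<^sub>F \<mu> in at 0. of_complex \<mu> + b \<in> invertibles"
proof -
  obtain u v where uv: "b = u + v" "T u = 0" "v \<in> invertibles" "u * v = v * u"
    using b by (auto simp: browder_elems_def null_space_def)
  define k where "k = invel v * u"
  have Tk: "T k = 0" using T(1) uv(2) by (simp add: k_def unital_hom_mult)
  have b_eq: "b = v * (1 + k)" using uv by (simp add: k_def distrib_left invel_right_assoc add.commute)
  have kv: "v * k = k * v" using uv by (simp add: k_def invel_right_assoc invel_left_assoc mult.assoc)
  have "\<forall>\<^sub>F z in at (- 1). of_complex z - k \<in> invertibles"
    using T Tk by (intro isolated_from_nonzero[of T]) auto
  then obtain \<delta> where \<delta>: "\<delta> > 0" "\<And>z. z \<noteq> - 1 \<Longrightarrow> dist z (- 1) < \<delta> \<Longrightarrow> of_complex z - k \<in> invertibles"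
    by (auto simp: eventually_at)
  have "- 1 \<notin> spectrum (T k)"
    unfolding Tk by (simp add: spectrum_iff invertibles_of_complex)
  note not_spec = this
  have iso: "z \<notin> spectrum k" if "0 < cmod (z - - 1)" "cmod (z - - 1) \<le> \<delta> / 2" for z
  proof -
    have "z \<noteq> - 1" using that(1) by auto
    moreover have "dist z (- 1) < \<delta>" unfolding dist_norm using that(2) \<delta>(1) by linarith
    ultimately show ?thesis using \<delta>(2) by (simp add: spectrum_iff)
  qed
  obtain p where p: "p * p = p" "\<And>x. x * k = k * x \<Longrightarrow> x * p = p * x"
      "\<exists>w. corner_inv (1 - p) (of_complex (- 1) - k) w" "T p = 0"
    by (rule riesz_idempotent[OF half_gt_zero[OF \<delta>(1)] iso T(1,2) not_spec]) blast+
  obtain w where "corner_inv (1 - p) (of_complex (- 1) - k) w" using p(3) by blast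
  define q where "q = 1 - p"
  have q: "q * q = q" using p(1) by (simp add: q_def algebra_simps)
  have pk: "p * k = k * p" "p * v = v * p" using p(2)[of k] p(2)[of v] kv by simp_all
  then have pb: "p * b = b * p" by (metis b_eq distrib_left distrib_right mult.assoc mult_1_left mult_1_right)
  have qb: "q * b = b * q" "q * k = k * q" "q * v = v * q" using pb pk by (simp_all add: q_def algebra_simps)
  define w' where "w' = - w"
  have w': "q * w' = w'" "w' * q = w'" "w' * ((1 + k) * q) = q" "q * ((1 + k) * w') = q"
  proof -
    have "of_complex (- 1) - k = - (1 + k)" by (simp add: of_complex_minus)
    then have "corner_inv q (- (1 + k)) w"
      using \<open>corner_inv (1 - p) (of_complex (- 1) - k) w\<close> by (simp only: q_def)
    then have "q * w = w \<and> w * q = w \<and> - (w * ((1 + k) * q)) = q \<and> - (q * ((1 + k) * w)) = q"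
      by (simp only: corner_inv_def mult_minus_left mult_minus_right mult.assoc)
    then show "q * w' = w'" "w' * q = w'" "w' * ((1 + k) * q) = q" "q * ((1 + k) * w') = q"
      by (simp_all only: w'_def mult_minus_left mult_minus_right)
  qed
  have kq: "(1 + k) * q = q * (1 + k)" using qb by (simp add: algebra_simps)
  \<comment> \<open>\<open>b1\<close> is b on the corner of q and the identity on that of p. It is
    invertible, and stays so after adding a small scalar.\<close>
  define b1 where "b1 = b * q + p"
  have "b1 \<in> invertibles"
  proof (rule invertiblesI)
    have qp: "q * p = 0" "p * q = 0" "q + p = 1" using p(1) by (simp_all add: q_def algebra_simps)
    have pw: "p * w' = 0" "w' * p = 0"
      using w' qp by (metis mult.assoc mult_zero_left mult_zero_right)+
    define m where "m = w' * invel v"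
    have qi: "invel v * q = q * invel v" "invel v * p = p * invel v"
      using uv qb pk by (simp_all add: invel_commute)
    have "b * q * m = v * ((1 + k) * (q * w')) * invel v"
      by (simp add: b_eq m_def mult.assoc)
    also have "(1 + k) * (q * w') = q" using w' kq by (metis mult.assoc)
    also have "v * q * invel v = q" using qb uv by (metis invel_right mult.assoc mult_1_right)
    finally have 1: "b * q * m = q" .
    have "m * (b * q) = w' * (invel v * v) * ((1 + k) * q)"
      by (simp add: b_eq m_def mult.assoc)
    then have 2: "m * (b * q) = q" using uv w' by (simp add: invel_left)
    have 3: "p * m = 0" "m * p = 0"
      by (simp_all add: m_def pw qi mult.assoc flip: mult.assoc)
        (metis mult.assoc pw(2) qi(2) mult_zero_left)
    show "b1 * (m + p) = 1" "(m + p) * b1 = 1"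
      using 1 2 3 p(1) qp pb
      by (simp_all add: b1_def distrib_left distrib_right mult.assoc)
        (metis mult.assoc mult_zero_left mult_zero_right add.right_neutral add.left_neutral)+
  qed
  moreover have "((\<lambda>\<mu>. of_complex \<mu> + b1) \<longlongrightarrow> of_complex 0 + b1) (at 0)"
    by (intro tendsto_intros)
  ultimately have ev1: "\<forall>\<^sub>F \<mu> in at 0. of_complex \<mu> + b1 \<in> invertibles"
    by (intro eventually_invertible) simp_all
  \<comment> \<open>On the corner of p, \<mu> + b agrees with (\<mu> + 1) - \<open>b2\<close>. The
    shift by 1 moves the question from the point 0, where the Riesz property allows accumulation, to
    the point 1.\<close>
  define b2 where "b2 = p - p * b"
  have "T b2 = 0"
    using T(1) p(4) by (simp add: b2_def unital_hom_mult unital_hom_diff)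
  then have "\<forall>\<^sub>F z in at 1. of_complex z - b2 \<in> invertibles"
    using T by (intro isolated_from_nonzero[of T]) auto
  then have ev2: "\<forall>\<^sub>F \<mu> in at 0. of_complex (\<mu> + 1) - b2 \<in> invertibles"
    by (simp add: at_to_0[of 1] eventually_filtermap)
  from ev1 ev2 show ?thesis
  proof eventually_elim
    case (elim \<mu>)
    have pbp: "p * (p * b) = p * b" "(p * b) * p = p * b" using p(1) pb by (metis mult.assoc)+
    have eq1: "(of_complex \<mu> + b) * p = (of_complex (\<mu> + 1) - b2) * p"
      using p(1) pbp pb by (simp add: b2_def algebra_simps of_complex_add)
    have "b1 * q = b * q" using q p(1) by (simp add: b1_def q_def algebra_simps)
    then have eq2: "(of_complex \<mu> + b) * (1 - p) = (of_complex \<mu> + b1) * (1 - p)"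
      by (simp add: q_def distrib_right)
    have "p * q = 0" "q * p = 0" using p(1) by (simp_all add: q_def algebra_simps)
    then have "p * (b * q) = 0" "(b * q) * p = 0" using pb by (metis mult.assoc mult_zero_right)+
    then have pb1: "p * b1 = b1 * p" by (simp add: b1_def distrib_left distrib_right)
    have pb2: "p * b2 = b2 * p" using pbp by (simp add: b2_def left_diff_distrib right_diff_distrib)
    have "p * (of_complex \<mu> + b) = (of_complex \<mu> + b) * p"
      "p * (of_complex (\<mu> + 1) - b2) = (of_complex (\<mu> + 1) - b2) * p"
      "p * (of_complex \<mu> + b1) = (of_complex \<mu> + b1) * p"
      unfolding distrib_left distrib_right left_diff_distrib right_diff_distrib
      by (simp_all only: of_complex_commute[of p] pb pb1 pb2)
    then show ?case
      using elim by (intro idempotent_sum_invertible[OF p(1) _ _ _ eq1 eq2])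
  qed
qed

section \<open>Projections in \<open>C\<^sup>*\<close>-algebras\<close>

lemma adj_scaleR: "adj (r *\<^sub>R x) = r *\<^sub>R adj (x::'a::cstar_algebra)"
  by (metis adj_scaleC complex_cnj_complex_of_real scaleC_of_real)

lemma adj_0 [simp]: "adj (0::'a::cstar_algebra) = 0"
  using adj_scaleR[of 0 "0::'a"] by simp

lemma adj_1 [simp]: "adj (1::'a::cstar_algebra) = 1"
  by (metis adj_adj adj_mult mult_1_left mult_1_right)

lemma adj_minus: "adj (- x) = - adj (x::'a::cstar_algebra)"
  using adj_scaleR[of "- 1" x] by simp

lemma adj_diff: "adj (x - y) = adj x - adj (y::'a::cstar_algebra)"
  using adj_add[of x "- y"] by (simp add: adj_minus)

lemma adj_of_complex: "adj (of_complex z) = (of_complex (cnj z) :: 'a::cstar_algebra)"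
  by (simp add: of_complex_def adj_scaleC)

lemma adj_of_complex_mult: "adj (of_complex z * x) = of_complex (cnj z) * adj (x::'a::cstar_algebra)"
  by (simp add: adj_mult adj_of_complex of_complex_commute)

lemma adj_sum: "adj (sum f F) = (\<Sum>i\<in>F. adj (f i :: 'a::cstar_algebra))"
  by (induction F rule: infinite_finite_induct) (simp_all add: adj_add)

lemma adj_invel:
  fixes x :: "'a::cstar_algebra"
  assumes "x \<in> invertibles" shows "adj (invel x) = invel (adj x)"
proof -
  have "adj x * adj (invel x) = 1" "adj (invel x) * adj x = 1"
    using assms by (simp_all add: invel_right invel_left flip: adj_mult)
  then show ?thesis using invel_unique by metis
qed

text \<open>Arens' argument: the point \<open>\<beta> (1 + t)\<close> lies in the spectrum of \<open>h + \<beta> t\<close>, whose norm is at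
  most \<open>sqrt (norm h\<^sup>2 + t\<^sup>2)\<close>.\<close>
lemma self_adjoint_imaginary_unit_notin_spectrum:
  fixes h :: "'a::cstar_algebra"
  assumes h: "adj h = h" and \<beta>: "cnj \<beta> = - \<beta>" "cmod \<beta> = 1"
  shows "\<beta> \<notin> spectrum h"
proof
  assume \<beta>_spec: "\<beta> \<in> spectrum h"
  define t where "t = (norm h)\<^sup>2"
  define b :: 'a where "b = of_complex (\<beta> * of_real t)"
  have "\<beta> * of_real (1 + t) \<in> spectrum (h + b)"
    using \<beta>_spec by (simp add: spectrum_iff b_def distrib_left of_complex_add algebra_simps)
  from spectrum_norm_le[OF this] have "1 + t \<le> norm (h + b)"
    using \<beta> by (simp add: norm_mult t_def del: of_real_add)
  then have "(1 + t)\<^sup>2 \<le> (norm (h + b))\<^sup>2"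
    by (intro power_mono) (auto simp: t_def)
  also have "\<dots> = norm (adj (h + b) * (h + b))" by (simp add: norm_adj_mult_self)
  also have "adj (h + b) = h - b"
    using \<beta> h by (simp add: adj_add b_def adj_of_complex of_complex_minus)
  also have "(h - b) * (h + b) = h * h - b * b"
    by (simp add: b_def algebra_simps of_complex_commute[of h])
  also have "norm \<dots> \<le> norm (h * h) + norm (b * b)" by (rule norm_triangle_ineq4)
  also have "norm (h * h) \<le> t" using norm_mult_ineq[of h h] by (simp add: t_def power2_eq_square)
  also have "norm (b * b) = t\<^sup>2"
    using \<beta> by (simp add: b_def norm_mult power2_eq_square flip: of_complex_mult)
  finally have "1 + t \<le> 0" by (simp add: power2_eq_square algebra_simps)
  moreover have "0 \<le> t" by (simp add: t_def)
  ultimately show False by simp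
qed

text \<open>The element factors as (\<i> - h) (- \<i> - h), and neither \<i> nor - \<i> is in the
  spectrum of h.\<close>

lemma invertible_1_plus_square:
  fixes h :: "'a::cstar_algebra"
  assumes "adj h = h" shows "1 + h * h \<in> invertibles"
proof -
  have "(of_complex \<i> - h) * (of_complex (- \<i>) - h) = of_complex (\<i> * - \<i>) + h * h"
    unfolding of_complex_mult by (simp add: algebra_simps of_complex_minus of_complex_commute[of h])
  then have "1 + h * h = (of_complex \<i> - h) * (of_complex (- \<i>) - h)" by simp
  also have "\<dots> \<in> invertibles"
    using assms self_adjoint_imaginary_unit_notin_spectrum[of h \<i>]
      self_adjoint_imaginary_unit_notin_spectrum[of h "- \<i>"]
    by (intro invertibles_mult) (auto simp: spectrum_iff)
  finally show ?thesis .
qed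

text \<open>Kaplansky's formula: Q = P \<open>adj P\<close> z^-1, where z = 1 - (P -
  \<open>adj P\<close>)^2 commutes with P and \<open>adj P\<close> and satisfies P z = P
  \<open>adj P\<close> P. It is invertible as 1 plus the square of the self-adjoint element \<i> (P
  - \<open>adj P\<close>).\<close>

lemma range_projection:
  fixes P :: "'a::cstar_algebra"
  assumes P: "P * P = P"
  shows "\<exists>Q. Q * Q = Q \<and> adj Q = Q \<and> Q * P = P \<and> P * Q = Q"
proof -
  define z where "z = 1 - (P - adj P) * (P - adj P)"
  define w where "w = invel z"
  define S where "S = adj P"
  have S: "S * S = S" using P by (simp add: S_def flip: adj_mult)
  have adj_PS: "adj P = S" "adj S = P" by (simp_all add: S_def adj_adj)
  have z_eq: "z = 1 - P - S + P * S + S * P"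
    unfolding z_def S_def[symmetric] by (simp add: algebra_simps P S)
  have "z = 1 + (of_complex \<i> * (P - S)) * (of_complex \<i> * (P - S))"
  proof -
    have "(of_complex \<i> * (P - S)) * (of_complex \<i> * (P - S)) = of_complex (\<i> * \<i>) * ((P - S) * (P - S))"
      unfolding of_complex_mult by (metis mult.assoc of_complex_commute)
    then show ?thesis by (simp add: z_def S_def of_complex_minus)
  qed
  moreover have "adj (of_complex \<i> * (P - S)) = of_complex \<i> * (P - S)"
    by (simp add: adj_of_complex_mult adj_diff adj_PS of_complex_minus algebra_simps)
  ultimately have z: "z \<in> invertibles" using invertible_1_plus_square by metis
  have Pz: "P * z = P * (S * P)" and zP: "z * P = P * (S * P)"
    unfolding z_eq by (simp_all add: algebra_simps P) (simp flip: mult.assoc add: P)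
  have adj_z: "adj z = z" by (simp add: z_eq adj_diff adj_add adj_mult adj_PS)
  have Sz: "S * z = z * S" using arg_cong[OF trans[OF Pz zP[symmetric]], of adj]
    by (simp add: adj_mult adj_z adj_PS)
  have wP: "w * P = P * w" and wS: "w * S = S * w"
    unfolding w_def using z Pz zP Sz by (simp_all add: invel_commute)
  have adj_w: "adj w = w" unfolding w_def using z by (simp add: adj_invel adj_z)
  define Q where "Q = P * (S * w)"
  have QP: "Q * P = P"
  proof -
    have "Q * P = (P * (S * P)) * w" by (simp add: Q_def mult.assoc wP)
    also have "\<dots> = P" unfolding Pz[symmetric] using z by (simp add: w_def invel_right mult.assoc)
    finally show ?thesis .
  qed
  have PQ: "P * Q = Q" by (simp add: Q_def P flip: mult.assoc)
  have "Q * Q = (Q * P) * (S * w)" by (simp add: Q_def mult.assoc)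
  then have "Q * Q = Q" unfolding QP by (simp add: Q_def)
  moreover have "adj Q = Q"
  proof -
    have "adj Q = w * P * S" by (simp add: Q_def adj_mult adj_PS adj_w)
    then show ?thesis by (simp add: Q_def wP wS mult.assoc)
  qed
  ultimately show ?thesis using QP PQ by blast
qed

section \<open>Series of orthogonal projections\<close>

lemma norm_projection_le_1:
  fixes Q :: "'a::cstar_algebra"
  assumes "Q * Q = Q" "adj Q = Q" shows "norm Q \<le> 1"
  using norm_adj_mult_self[of Q] assms by (auto simp: power2_eq_square)

text \<open>The supremum \<open>M\<close> of these norms satisfies \<open>M\<^sup>2 \<le> M\<close> by the \<open>C\<^sup>*\<close>-identity.\<close>
lemma norm_sum_projections_le_1:
  fixes q :: "'i \<Rightarrow> 'a::cstar_algebra"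
  assumes F: "finite F" and q: "\<And>i. q i * q i = q i" "\<And>i. adj (q i) = q i"
    "\<And>i j. i \<noteq> j \<Longrightarrow> q i * q j = 0"
    and e: "\<And>i. i \<in> F \<Longrightarrow> cmod (e i) \<le> 1"
  shows "norm (\<Sum>i\<in>F. of_complex (e i) * q i) \<le> 1"
proof -
  define E where "E = {e. \<forall>i\<in>F. cmod (e i) \<le> 1}"
  define N where "N = (\<lambda>e. norm (\<Sum>i\<in>F. of_complex (e i) * q i))"
  define M where "M = (SUP e\<in>E. N e)"
  \<comment> \<open>A crude bound, which makes the supremum M finite.\<close>
  have "N e \<le> real (card F)" if "e \<in> E" for e
  proof -
    have "N e \<le> (\<Sum>i\<in>F. 1)"
      unfolding N_def
    proof (rule order_trans[OF norm_sum sum_mono])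
      fix i assume "i \<in> F"
      then show "norm (of_complex (e i) * q i) \<le> 1"
        using that norm_projection_le_1[of "q i"] q
        by (auto simp: E_def norm_of_complex_mult intro: mult_le_one)
    qed
    then show ?thesis by simp
  qed
  then have "bdd_above (N ` E)" by (auto intro!: bdd_aboveI)
  then have N_le: "N e \<le> M" if "e \<in> E" for e
    unfolding M_def using that by (rule cSUP_upper2) auto
  have "E \<noteq> {}" by (auto simp: E_def intro!: exI[of _ "\<lambda>_. 0"])
  have "N e \<le> sqrt M" if "e \<in> E" for e
  proof -
    let ?s = "\<Sum>i\<in>F. of_complex (e i) * q i"
    have "adj ?s * ?s = (\<Sum>i\<in>F. \<Sum>j\<in>F. of_complex (cnj (e i)) * q i * (of_complex (e j) * q j))"
      by (simp add: adj_sum adj_of_complex_mult q sum_product)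
    also have "\<dots> = (\<Sum>i\<in>F. \<Sum>j\<in>F. if i = j then of_complex (cnj (e i) * e i) * q i else 0)"
    proof (intro sum.cong refl)
      fix i j
      have "of_complex (cnj (e i)) * q i * (of_complex (e j) * q j) =
          of_complex (cnj (e i) * e j) * (q i * q j)"
        unfolding of_complex_mult by (metis mult.assoc of_complex_commute)
      then show "of_complex (cnj (e i)) * q i * (of_complex (e j) * q j) =
          (if i = j then of_complex (cnj (e i) * e i) * q i else 0)"
        by (simp add: q)
    qed
    also have "\<dots> = (\<Sum>i\<in>F. of_complex (cnj (e i) * e i) * q i)"
      using F by simp
    \<comment> \<open>By orthogonality the C-star identity turns the coefficients into their squared
      moduli, which again lie in the unit disc.\<close>
    finally have "(N e)\<^sup>2 = N (\<lambda>i. cnj (e i) * e i)"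
      unfolding N_def by (simp flip: norm_adj_mult_self)
    also have "\<dots> \<le> M"
      using that by (intro N_le) (auto simp: E_def norm_mult mult_le_one)
    finally show ?thesis by (simp add: real_le_rsqrt)
  qed
  then have "M \<le> sqrt M"
    unfolding M_def using \<open>E \<noteq> {}\<close> by (intro cSUP_least) (auto simp: M_def)
  have "M \<le> 1"
  proof (rule ccontr)
    assume "\<not> M \<le> 1"
    then have "sqrt M * 1 < sqrt M * sqrt M" by (intro mult_strict_left_mono) auto
    then show False using \<open>M \<le> sqrt M\<close> \<open>\<not> M \<le> 1\<close> by simp
  qed
  moreover have "N e \<le> M" using e by (intro N_le) (simp add: E_def)
  ultimately show ?thesis by (simp add: N_def)
qed

lemma norm_sum_projections_le:
  fixes q :: "'i \<Rightarrow> 'a::cstar_algebra"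
  assumes F: "finite F" and q: "\<And>i. q i * q i = q i" "\<And>i. adj (q i) = q i"
    "\<And>i j. i \<noteq> j \<Longrightarrow> q i * q j = 0"
    and e: "\<And>i. i \<in> F \<Longrightarrow> cmod (e i) \<le> B" and B: "0 \<le> B"
  shows "norm (\<Sum>i\<in>F. of_complex (e i) * q i) \<le> B"
proof (cases "B = 0")
  case True
  then show ?thesis using e by simp
next
  case False
  then have "B > 0" using B by simp
  define s where "s = (\<Sum>i\<in>F. of_complex (e i / of_real B) * q i)"
  have "norm s \<le> 1"
    unfolding s_def using \<open>B > 0\<close> e
    by (intro norm_sum_projections_le_1[OF F q]) (auto simp: norm_divide)
  moreover have "(\<Sum>i\<in>F. of_complex (e i) * q i) = of_complex (of_real B) * s"
    using \<open>B > 0\<close> by (simp add: s_def sum_distrib_left flip: mult.assoc of_complex_mult)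
  ultimately show ?thesis using \<open>B > 0\<close> by (simp add: norm_of_complex_mult)
qed

text \<open>The norm of a combination of orthogonal projections is bounded by its largest
  coefficient, so coefficients tending to 0 suffice for convergence; absolute convergence may fail.
  The same bound passes to the tails.\<close>

lemma normal_series:
  fixes q :: "nat \<Rightarrow> 'a::cstar_algebra"
  assumes q: "\<And>i. q i * q i = q i" "\<And>i. adj (q i) = q i" "\<And>i j. i \<noteq> j \<Longrightarrow> q i * q j = 0"
    and e: "e \<longlonglongrightarrow> 0"
  obtains d where "(\<lambda>i. of_complex (e i) * q i) sums d" "normal_elem d"
    "\<And>i. d * q i = of_complex (e i) * q i" "\<And>i. q i * d = of_complex (e i) * q i"
    "\<And>n B. 0 \<le> B \<Longrightarrow> (\<And>i. n \<le> i \<Longrightarrow> cmod (e i) \<le> B) \<Longrightarrow>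
      norm (d - (\<Sum>i<n. of_complex (e i) * q i)) \<le> B"
proof -
  define f where "f = (\<lambda>i. of_complex (e i) * q i)"
  have "summable f"
    unfolding summable_Cauchy
  proof (intro allI impI)
    fix \<epsilon> :: real assume "\<epsilon> > 0"
    then obtain N where N: "\<And>i. i \<ge> N \<Longrightarrow> cmod (e i) < \<epsilon> / 2"
      using e[unfolded LIMSEQ_iff, rule_format, of "\<epsilon> / 2"] by auto
    have "norm (sum f {m..<n}) < \<epsilon>" if "m \<ge> N" for m n
    proof -
      have "norm (sum f {m..<n}) \<le> \<epsilon> / 2"
        unfolding f_def
      proof (rule norm_sum_projections_le[OF finite_atLeastLessThan q])
        show "cmod (e i) \<le> \<epsilon> / 2" if "i \<in> {m..<n}" for i
          using N[of i] that \<open>m \<ge> N\<close> by simp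
      qed (use \<open>\<epsilon> > 0\<close> in auto)
      then show ?thesis using \<open>\<epsilon> > 0\<close> by simp
    qed
    then show "\<exists>N. \<forall>m\<ge>N. \<forall>n. norm (sum f {m..<n}) < \<epsilon>" by blast
  qed
  then obtain d where d: "f sums d" by (auto simp: summable_def)
  have fq: "f i * q k = (if i = k then f k else 0)" "q k * f i = (if i = k then f k else 0)" for i k
    using q by (auto simp: f_def mult.assoc of_complex_left_commute)
  have dq: "d * q k = f k" for k
    using sums_mult2[OF d, of "q k"] sums_single[of k "\<lambda>_. f k"] unfolding fq by (rule sums_unique2)
  have qd: "q k * d = f k" for k
    using sums_mult[OF d, of "q k"] sums_single[of k "\<lambda>_. f k"] unfolding fq by (rule sums_unique2)
  \<comment> \<open>Multiplication by \<open>adj d\<close> on either side of \<open>q i\<close>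
    gives the adjoint of \<open>f i\<close>. Termwise commutation then passes to the sum and gives
    normality.\<close>
  have "f i * adj d = adj d * f i" for i
  proof -
    have "q i * adj d = adj (f i)" "adj d * q i = adj (f i)"
      using arg_cong[OF dq[of i], of adj] arg_cong[OF qd[of i], of adj] by (simp_all add: adj_mult q)
    then show ?thesis by (simp add: f_def mult.assoc of_complex_left_commute)
  qed
  then have "d * adj d = adj d * d"
    using sums_unique2[OF sums_mult2[OF d, of "adj d"]] sums_mult[OF d, of "adj d"] by simp
  moreover have "norm (d - sum f {..<n}) \<le> B"
    if B: "0 \<le> B" "\<And>i. n \<le> i \<Longrightarrow> cmod (e i) \<le> B" for n B
  proof (rule Lim_bounded)
    show "(\<lambda>m. norm (sum f {..<m} - sum f {..<n})) \<longlonglongrightarrow> norm (d - sum f {..<n})"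
      using d unfolding sums_def by (intro tendsto_intros)
    show "\<forall>m\<ge>n. norm (sum f {..<m} - sum f {..<n}) \<le> B"
    proof (intro allI impI)
      fix m assume "n \<le> m"
      then have "sum f {..<m} - sum f {..<n} = sum f {n..<m}"
        by (simp add: sum_diff_nat_ivl lessThan_atLeast0)
      also have "norm \<dots> \<le> B"
        unfolding f_def using B by (intro norm_sum_projections_le q) auto
      finally show "norm (sum f {..<m} - sum f {..<n}) \<le> B" .
    qed
  qed
  ultimately show thesis
    using that[of d] d dq qd unfolding f_def normal_elem_def by blast
qed

text \<open>The inverse of an upper triangular 2 by 2 block matrix: the diagonal blocks are
  inverted, and the off-diagonal block is - u x v.\<close>

lemma corner_inv_triangular:
  assumes Q: "Q * Q = Q" "R * R = R" "Q * R = 0" "R * Q = 0" and tri: "R * x * Q = 0"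
    and u: "corner_inv Q x u" and v: "corner_inv R x v"
  shows "corner_inv (Q + R) x (u + v - u * x * v)"
proof -
  have u': "Q * u = u" "u * Q = u" "u * x * Q = Q" "Q * x * u = Q"
    and v': "R * v = v" "v * R = v" "v * x * R = R" "R * x * v = R"
    using u v by (auto simp: corner_inv_def)
  have 0: "R * u = 0" "u * R = 0" "Q * v = 0" "v * Q = 0"
    by (metis u' v' Q mult.assoc mult_zero_left mult_zero_right)+
  have a: "Q * (u * x * v) = u * x * v" "(u * x * v) * R = u * x * v" "R * (u * x * v) = 0" "(u * x * v) * Q = 0"
    using u' v' 0 by (metis mult.assoc mult_zero_left mult_zero_right)+
  have vxQ: "v * x * Q = 0" using v' tri by (metis mult.assoc mult_zero_right)
  have Rxu: "R * x * u = 0" using u' tri by (metis mult.assoc mult_zero_left)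
  have b: "u * x * v * x * Q = 0" "u * x * v * x * R = u * x * R"
    "Q * x * (u * x * v) = Q * x * v" "R * x * (u * x * v) = 0"
  proof -
    show "u * x * v * x * Q = 0" using vxQ by (simp add: mult.assoc)
    show "u * x * v * x * R = u * x * R" using v'(3) by (simp add: mult.assoc)
    have "Q * x * (u * x * v) = (Q * x * u) * x * v" by (simp add: mult.assoc)
    then show "Q * x * (u * x * v) = Q * x * v" using u' by simp
    have "R * x * (u * x * v) = (R * x * u) * x * v" by (simp add: mult.assoc)
    then show "R * x * (u * x * v) = 0" using Rxu by simp
  qed
  show ?thesis
    unfolding corner_inv_def
    by (simp add: distrib_left distrib_right left_diff_distrib right_diff_distrib a b u' v' 0 vxQ Rxu)
qed

text \<open>For idempotents \<open>P \<le> P'\<close> with range projections \<open>Q \<le> Q'\<close>, compression to \<open>Q' - Q\<close> is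
  multiplicative on the commutant of \<open>P\<close> and \<open>P'\<close>, and it maps \<open>P' - P\<close> to \<open>Q' - Q\<close>.\<close>
lemma corner_inv_compress:
  assumes P: "P * P' = P" "P' * P = P" and QP: "Q * P = P" "P * Q = Q" "Q' * P' = P'" "P' * Q' = Q'"
    and Q: "Q * Q = Q" "Q' * Q' = Q'" "Q * Q' = Q"
    and x: "x * P = P * x" "x * P' = P' * x" and w: "w * P = P * w" "w * P' = P' * w"
    and cinv: "corner_inv (P' - P) x w"
  shows "corner_inv (Q' - Q) x ((Q' - Q) * w * (Q' - Q))"
proof -
  define q where "q = Q' - Q"
  have Q'Q: "Q' * Q = Q" by (metis P QP mult.assoc)
  have qq: "q * q = q" "q * Q = 0" "Q' * q = q" "q * Q' = q"
    using Q Q'Q by (simp_all add: q_def algebra_simps)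
  have compress: "q * y * q * z * q = q * y * z * q"
    if y: "y * P = P * y" "y * P' = P' * y" and z: "z * P = P * z" "z * P' = P' * z" for y z
  proof -
    \<comment> \<open>P and Q have the same range, so whatever commutes with P leaves the range of Q
      invariant; likewise for P' and Q'.\<close>
    have "y * Q = Q * (y * Q)" by (metis QP y mult.assoc)
    then have "q * (y * Q) = 0" using qq by (metis mult.assoc mult_zero_left)
    moreover have "z * Q' = Q' * (z * Q')" by (metis QP z mult.assoc)
    then have "Q' * (z * q) = z * q" using qq by (metis mult.assoc)
    moreover have "q * y * q * z * q = q * y * (Q' * (z * q)) - q * (y * Q) * (z * q)"
      by (simp add: q_def algebra_simps)
    ultimately show ?thesis by (simp add: mult.assoc)
  qed
  define r where "r = P' - P"
  have c: "r * w = w" "w * r = w" "w * x * r = r" "r * x * w = r"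
    using cinv by (auto simp: corner_inv_def r_def)
  have "x * r = r * x" using x by (simp add: r_def algebra_simps)
  then have wx: "w * x = r" "x * w = r" using c by (metis mult.assoc)+
  \<comment> \<open>The unit of the corner of P' - P compresses to the unit of the corner of Q' - Q,
    because P' fixes the range of q and q kills P.\<close>
  have "q * r * q = q"
  proof -
    have "P' * Q = Q" "Q' * P = P" using P QP by (metis mult.assoc)+
    then have "P' * q = q" "q * P = 0" using QP by (simp_all add: q_def algebra_simps)
    then have "q * P' * q = q" "q * P * q = 0" using qq by (simp_all add: mult.assoc)
    then show ?thesis by (simp add: r_def algebra_simps)
  qed
  then have "q * w * q * x * q = q" "q * x * q * w * q = q"
    using compress[OF w x] compress[OF x w] wx by (simp_all add: mult.assoc)
  then have "corner_inv q x (q * w * q)"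
    unfolding corner_inv_def using qq by (metis mult.assoc)
  then show ?thesis by (simp add: q_def)
qed

section \<open>The West decomposition\<close>

lemma corner_inv_mult:
  assumes r: "r * r = r" "x * r = r * x" and s: "s * s = s" "s * r = r * s" "s * x = x * s"
    and w: "corner_inv r x w"
  shows "corner_inv (r * s) x (w * s)"
proof -
  have w': "r * w = w" "w * r = w" "w * x * r = r" "r * x * w = r"
    using w by (auto simp: corner_inv_def)
  have sw: "s * w = w * s"
    using corner_inv_commute[OF w r s(3) s(2)] .
  have "(r * s) * (w * s) = (r * w) * s" "(w * s) * (r * s) = (w * r) * s"
    using s sw by (metis mult.assoc)+
  moreover have "(w * s) * x * (r * s) = (w * x * r) * s" "(r * s) * x * (w * s) = (r * x * w) * s"
    using s sw by (metis mult.assoc)+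
  ultimately show ?thesis using w' by (simp add: corner_inv_def)
qed

text \<open>The new inverse is (1 + W h R)^-1 W = W (1 + R h W)^-1. The first form verifies the left
  equation, the second the right one, which is why both norms are assumed small.\<close>

lemma corner_inv_perturb:
  assumes R: "R * R = R" and W: "corner_inv R y W"
    and h: "norm (W * h * R) < 1" "norm (R * h * W) < 1"
  shows "\<exists>W'. corner_inv R (y + h) W'"
proof -
  have w: "R * W = W" "W * R = W" "W * y * R = R" "R * y * W = R"
    using W by (auto simp: corner_inv_def)
  define u u' where "u = 1 - - (W * h * R)" and "u' = 1 - - (R * h * W)"
  have inv: "u \<in> invertibles" "u' \<in> invertibles"
    unfolding u_def u'_def using h by (intro Neumann_invertible; simp)+
  have Ru: "u * R = R + W * h * R" "R * u = R + W * h * R"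
    using R w by (simp_all add: u_def distrib_left distrib_right mult.assoc) (simp_all flip: mult.assoc)
  have Ru': "R * u' = R + R * h * W"
    using R w by (simp add: u'_def distrib_left flip: mult.assoc)
  have "u * W = W + W * h * W" "W * u' = W + W * h * W"
    using w by (simp_all add: u_def u'_def distrib_left distrib_right mult.assoc) (simp_all flip: mult.assoc)
  then have uW: "u * W = W * u'" by simp
  define V where "V = invel u * W"
  have V': "V = W * invel u'"
    unfolding V_def using inv uW by (metis invel_left invel_right mult.assoc mult_1_left mult_1_right)
  have Rv: "invel u * R = R * invel u" using inv Ru by (intro invel_commute) simp_all
  have "R * V = V" by (metis Rv V_def mult.assoc w(1))
  moreover have "V * R = V" using w by (simp add: V_def mult.assoc)
  moreover have "V * (y + h) * R = R"
  proof -
    have "V * (y + h) * R = invel u * (W * y * R + W * h * R)"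
      by (simp add: V_def algebra_simps)
    also have "W * y * R + W * h * R = u * R" using Ru w by simp
    finally show ?thesis using inv by (simp add: invel_left_assoc)
  qed
  moreover have "R * (y + h) * V = R"
  proof -
    have "R * (y + h) * V = (R * y * W + R * h * W) * invel u'"
      by (simp add: V' algebra_simps)
    also have "R * y * W + R * h * W = R * u'" using Ru' w by simp
    finally show ?thesis using inv by (simp add: invel_right mult.assoc)
  qed
  ultimately show ?thesis unfolding corner_inv_def by blast
qed

text \<open>The \<open>l i\<close> enumerate the spectral points off \<Omega>; entries with
  \<open>p i = 0\<close> serve as padding when there are only finitely many. In
  \<open>tail_spec\<close>, s = 0 is the case of \<mu> off the spectrum, and s = \<open>p i\<close>
  removes the spectral point \<mu> itself.\<close>

lemma west_decomposition:
  fixes a :: "'a::cstar_algebra" and p :: "nat \<Rightarrow> 'a" and l m :: "nat \<Rightarrow> complex"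
    and T :: "'a \<Rightarrow> 'b::complex_banach_algebra"
  assumes p: "\<And>i. p i * p i = p i" "\<And>i j. i \<noteq> j \<Longrightarrow> p i * p j = 0" "\<And>i. p i * a = a * p i"
    and p_spec: "\<And>i \<zeta>. \<zeta> \<noteq> l i \<Longrightarrow> \<exists>w. corner_inv (p i) (of_complex \<zeta> - a) w"
    and tail_spec: "\<And>\<mu>. \<mu> \<notin> \<Omega> \<Longrightarrow> \<exists>s \<in> insert 0 (range p). \<exists>w. corner_inv (1 - s) (of_complex \<mu> - a) w"
    and m: "\<And>i. m i \<in> \<Omega>" "(\<lambda>i. l i - m i) \<longlonglongrightarrow> 0"
    and T: "unital_hom T" "bounded_linear T" "\<And>i. T (p i) = 0"
  obtains d where "normal_elem d" "T d = 0" "spectrum (a - d) \<subseteq> \<Omega>"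
proof -

  \<comment> \<open>The flag of range projections and the normal series\<close>
  define P where "P = (\<lambda>n. \<Sum>i<n. p i)"
  have pP: "p i * P n = (if i < n then p i else 0)" "P n * p i = (if i < n then p i else 0)" for i n
  proof -
    have "p i * P n = (\<Sum>j<n. if i = j then p i else 0)" "P n * p i = (\<Sum>j<n. if i = j then p i else 0)"
      unfolding P_def sum_distrib_left sum_distrib_right by (rule sum.cong; use p(1,2) in auto)+
    then show "p i * P n = (if i < n then p i else 0)" "P n * p i = (if i < n then p i else 0)"
      by simp_all
  qed
  have PP: "P i * P n = P i" "P n * P i = P i" if "i \<le> n" for i n
  proof -
    have Pi: "P i = (\<Sum>j<i. p j)" by (simp add: P_def)
    have "(\<Sum>j<i. p j * P n) = (\<Sum>j<i. p j)" "(\<Sum>j<i. P n * p j) = (\<Sum>j<i. p j)"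
      using that by (auto simp: pP intro!: sum.cong)
    then show "P i * P n = P i" "P n * P i = P i"
      by (simp_all only: Pi sum_distrib_left sum_distrib_right)
  qed
  have PPc: "P i * P n = P n * P i" for i n
    using PP by (cases "i \<le> n") simp_all
  have aP: "P n * a = a * P n" for n
    by (simp add: P_def sum_distrib_left sum_distrib_right p)
  have zaP: "P n * (of_complex \<zeta> - a) = (of_complex \<zeta> - a) * P n" for n \<zeta>
    by (simp add: algebra_simps aP of_complex_commute)
  have pPc: "P n * p i = p i * P n" for n i by (simp add: pP)
  have za_p: "p n * (of_complex \<zeta> - a) = (of_complex \<zeta> - a) * p n" for n \<zeta>
    by (simp add: algebra_simps p of_complex_commute)
  have "\<forall>n. \<exists>Q. Q * Q = Q \<and> adj Q = Q \<and> Q * P n = P n \<and> P n * Q = Q"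
    using range_projection PP by blast
  then obtain Q where Q: "\<And>n. Q n * Q n = Q n" "\<And>n. adj (Q n) = Q n"
      "\<And>n. Q n * P n = P n" "\<And>n. P n * Q n = Q n"
    by metis
  have Q0: "Q 0 = 0" using Q(4)[of 0] by (simp add: P_def)
  have QQ: "Q n * Q k = Q k" "Q k * Q n = Q k" if "k \<le> n" for k n
  proof -
    have "Q n * Q k = Q n * (P n * (P k * Q k))" using Q PP[OF that] by (metis mult.assoc)
    also have "\<dots> = P n * (P k * Q k)" using Q by (simp flip: mult.assoc)
    also have "\<dots> = Q k" using Q PP[OF that] by (metis mult.assoc)
    finally show 1: "Q n * Q k = Q k" .
    show "Q k * Q n = Q k" using arg_cong[OF 1, of adj] by (simp add: adj_mult Q)
  qed
  define q where "q = (\<lambda>n. Q (Suc n) - Q n)"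
  have q: "q i * q i = q i" "adj (q i) = q i" for i
    by (simp_all add: q_def algebra_simps adj_diff Q QQ)
  have q_orth: "q i * q j = 0" if "i \<noteq> j" for i j
    using that by (cases "i < j") (simp_all add: q_def algebra_simps QQ)
  define e where "e = (\<lambda>i. l i - m i)"
  obtain d where d: "(\<lambda>i. of_complex (e i) * q i) sums d" "normal_elem d"
    "\<And>i. d * q i = of_complex (e i) * q i" "\<And>i. q i * d = of_complex (e i) * q i"
    "\<And>n B. 0 \<le> B \<Longrightarrow> (\<And>i. n \<le> i \<Longrightarrow> cmod (e i) \<le> B) \<Longrightarrow>
      norm (d - (\<Sum>i<n. of_complex (e i) * q i)) \<le> B"
    using normal_series[of q e] q q_orth m(2) unfolding e_def by blast
  have Tq: "T (q n) = 0" for n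
  proof -
    have "T (P n) = 0" for n
      unfolding P_def using T by (simp add: bounded_linear.linear linear_sum)
    then have "T (Q n) = 0" for n
      using unital_hom_mult[OF T(1), of "P n" "Q n"] by (simp add: Q)
    then show ?thesis using T(1) by (simp add: q_def unital_hom_diff)
  qed
  have "T d = 0"
    using bounded_linear.sums[OF T(2) d(1)] T(1) Tq sums_unique2[OF _ sums_zero]
    by (simp add: unital_hom_mult)

  \<comment> \<open>Invertibility off \<Omega>: diagonal blocks and tail\<close>
  moreover have "of_complex \<mu> - (a - d) \<in> invertibles" if \<mu>: "\<mu> \<notin> \<Omega>" for \<mu>
  proof -
    define x where "x = of_complex \<mu> - a + d"
    define D where "D = (\<lambda>n. \<Sum>i<n. of_complex (e i) * q i)"
    have Q_sum: "Q n = (\<Sum>i<n. q i)" for n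
      using sum_lessThan_telescope[of Q n] by (simp add: q_def Q0)
    have dQ: "d * Q n = D n" "Q n * d = D n" for n
      by (simp_all add: Q_sum D_def sum_distrib_left sum_distrib_right d)
    have QD: "Q n * D n = D n" "D n * Q n = D n" for n
    proof -
      have "Q n * (Q n * d) = Q n * d" "(d * Q n) * Q n = d * Q n"
        by (simp add: Q flip: mult.assoc) (simp add: Q mult.assoc)
      then show "Q n * D n = D n" "D n * Q n = D n" by (simp_all only: dQ)
    qed
    have aQ: "(of_complex \<mu> - a) * Q n = Q n * ((of_complex \<mu> - a) * Q n)" for n
    proof -
      have "(of_complex \<mu> - a) * Q n = P n * ((of_complex \<mu> - a) * Q n)"
        using Q(4)[of n] zaP[of n \<mu>] by (metis mult.assoc)
      then show ?thesis using Q(3)[of n] by (metis mult.assoc)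
    qed
    have xQ: "x * Q n = Q n * (x * Q n)" for n
    proof -
      have "x * Q n = (of_complex \<mu> - a) * Q n + D n" by (simp add: x_def distrib_right dQ)
      then show ?thesis using QD(1)[of n] aQ[of n] by (metis distrib_left)
    qed
    \<comment> \<open>On the block \<open>q n\<close> the element d acts as \<open>e n\<close>, so x
      compresses like \<mu> + \<open>e n\<close> - a. If \<mu> + \<open>e n\<close> were
      \<open>l n\<close>, then \<mu> would be \<open>m n\<close>, a point of \<Omega>.\<close>
    have qx: "\<exists>w. corner_inv (q n) x w" for n
    proof -
      define y where "y = of_complex (\<mu> + e n) - a"
      have "\<mu> + e n \<noteq> l n" using m(1)[of n] \<mu> by (auto simp: e_def)
      then obtain w where w: "corner_inv (p n) y w" unfolding y_def using p_spec by blast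
      have wP: "w * P k = P k * w" for k
        by (rule sym, rule corner_inv_commute[OF w]) (simp_all add: p y_def za_p zaP pPc)
      have pn: "p n = P (Suc n) - P n" by (simp add: P_def)
      have "corner_inv (q n) y (q n * w * q n)"
        unfolding q_def
        by (rule corner_inv_compress[of "P n"])
          (use w wP in \<open>simp_all add: pn PP Q QQ y_def zaP\<close>)
      moreover have "q n * y * q n = q n * x * q n"
        by (simp add: x_def y_def of_complex_add algebra_simps d of_complex_left_commute[of "q n"] q)
      ultimately show ?thesis using corner_inv_cong by blast
    qed
    \<comment> \<open>The element x leaves the range of each \<open>Q n\<close> invariant, so the
      diagonal blocks are assembled one at a time by the triangular formula.\<close>
    have Qx: "\<exists>w. corner_inv (Q n) x w" for n
    proof (induction n)
      case 0
      then show ?case using corner_inv_0 by (auto simp: Q0)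
    next
      case (Suc n)
      obtain u v where "corner_inv (Q n) x u" "corner_inv (q n) x v"
        using Suc qx by blast
      moreover have o: "Q n * q n = 0" "q n * Q n = 0" by (simp_all add: q_def algebra_simps Q QQ)
      moreover have "q n * x * Q n = 0" using o(2) xQ[of n] by (metis mult.assoc mult_zero_left)
      ultimately have "corner_inv (Q n + q n) x (u + v - u * x * v)"
        by (intro corner_inv_triangular Q q)
      then show ?case by (auto simp: q_def)
    qed
    obtain s w where s: "s \<in> insert 0 (range p)" and w: "corner_inv (1 - s) (of_complex \<mu> - a) w"
      using tail_spec[OF \<mu>] by blast
    have ss: "s * s = s" "s * a = a * s" "\<And>n. P n * s = s * P n"
      using s p pPc by auto
    obtain n0 where n0: "\<And>n. n \<ge> n0 \<Longrightarrow> s * P n = s"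
    proof (cases "s = 0")
      case False
      then obtain k where "s = p k" using s by auto
      then show ?thesis by (intro that[of "Suc k"]) (simp add: pP)
    qed (use that in auto)
    \<comment> \<open>The admissible size of the tail of d: it gives \<open>norm w * B\<close> < 1,
      and the added 1 keeps the denominator positive if w = 0.\<close>
    define B where "B = 1 / (2 * (norm w + 1))"
    have B: "B > 0" "norm w * B < 1"
    proof -
      have pos: "0 < 2 * (norm w + 1)" by (simp add: add_nonneg_pos)
      then show "B > 0" by (simp add: B_def)
      have "norm w < 2 * (norm w + 1)" by (rule less_le_trans[of _ "norm w + 1"]) auto
      with pos have "norm w / (2 * (norm w + 1)) < 1" by (simp only: divide_less_eq_1_pos)
      then show "norm w * B < 1" by (simp add: B_def)
    qed
    obtain n1 where n1: "\<And>i. i \<ge> n1 \<Longrightarrow> cmod (e i) < B"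
      using m(2)[folded e_def, unfolded LIMSEQ_iff, rule_format, OF B(1)] by auto
    \<comment> \<open>From \<open>n0\<close> on, \<open>P n\<close> absorbs s, so the tail avoids
      the spectral point \<mu>; from \<open>n1\<close> on, the remaining coefficients are below
      B.\<close>
    define n where "n = max n0 n1"
    define R where "R = 1 - Q n"
    have R: "R * R = R" "adj R = R" "Q n * R = 0" "R * Q n = 0"
      using Q by (simp_all add: R_def algebra_simps adj_diff)
    define r where "r = 1 - P n"
    have r: "r * r = r" "R * r = R" "r * R = r"
      using Q PP[of n n] by (simp_all add: R_def r_def algebra_simps)
    have r_eq: "(1 - s) * r = r" using n0[of n] by (simp add: r_def n_def algebra_simps)
    have comm: "(1 - s) * (1 - s) = 1 - s" "(of_complex \<mu> - a) * (1 - s) = (1 - s) * (of_complex \<mu> - a)"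
      "r * (1 - s) = (1 - s) * r" "r * (of_complex \<mu> - a) = (of_complex \<mu> - a) * r"
      using ss zaP[of n \<mu>] by (simp_all add: r_def algebra_simps of_complex_commute)
    have rw: "r * w = w * r" using corner_inv_commute[OF w comm(1,2,4,3)] .
    have cr: "corner_inv r (of_complex \<mu> - a) (w * r)"
      using corner_inv_mult[OF comm(1,2) r(1) comm(3,4) w] unfolding r_eq .
    have wrP: "(w * r) * P k = P k * (w * r)" for k
      by (rule sym, rule corner_inv_commute[OF cr])
        (simp_all add: r comm zaP, simp add: r_def algebra_simps PPc)
    define W where "W = R * w * R"
    \<comment> \<open>Compression with P' = Q' = 1 moves the inverse from the corner of 1 -
      \<open>P n\<close> to that of the projection 1 - \<open>Q n\<close>.\<close>
    have "corner_inv R (of_complex \<mu> - a) (R * (w * r) * R)"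
      unfolding R_def
      by (rule corner_inv_compress[of "P n" 1])
        (use cr wrP in \<open>simp_all add: r_def Q zaP\<close>)
    moreover have "R * (w * r) * R = W" by (metis W_def r(2) rw mult.assoc)
    ultimately have cW: "corner_inv R (of_complex \<mu> - a) W" by simp
    define h where "h = d - D n"
    have h: "norm h \<le> B" unfolding h_def D_def
      by (rule d(5)) (use B(1) n1 in \<open>auto simp: n_def intro!: less_imp_le\<close>)
    have nR: "norm R \<le> 1" using R by (intro norm_projection_le_1)
    have contract: "norm (x * y) \<le> c" if "norm x \<le> c" "norm y \<le> 1" for x y :: 'a and c
      by (rule order_trans[OF norm_mult_ineq order_trans[OF mult_left_le[OF that(2) norm_ge_zero] that(1)]])
    have contract': "norm (x * y) \<le> c" if "norm x \<le> 1" "norm y \<le> c" for x y :: 'a and c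
      by (rule order_trans[OF norm_mult_ineq
            order_trans[OF mult_left_le_one_le[OF norm_ge_zero norm_ge_zero that(1)] that(2)]])
    \<comment> \<open>This bound is independent of n, which was chosen only after B. Projections
      rather than the idempotents \<open>P n\<close>, whose norms may grow, make this
      possible.\<close>
    have nW: "norm W \<le> norm w" unfolding W_def using nR by (intro contract contract') auto
    have "norm (W * h) \<le> norm w * B" "norm (h * W) \<le> norm w * B"
      using norm_mult_ineq[of W h] norm_mult_ineq[of h W] mult_mono[OF nW h] by (simp_all add: mult.commute)
    then have "norm (W * h * R) \<le> norm w * B" "norm (R * (h * W)) \<le> norm w * B"
      using nR by (auto intro: contract contract')
    then obtain v where v: "corner_inv R (of_complex \<mu> - a + h) v"
      using corner_inv_perturb[OF R(1) cW, of h] B(2) by (auto simp: mult.assoc)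
    \<comment> \<open>On the corner of R only the tail h of d is seen, so the small perturbation and
      x have the same compression.\<close>
    have "D n * R = 0" using QD(2)[of n] R(3) by (metis mult.assoc mult_zero_right)
    then have "R * (of_complex \<mu> - a + h) * R = R * x * R"
      by (simp add: h_def x_def algebra_simps)
    with v have v: "corner_inv R x v" using corner_inv_cong by blast
    obtain u where u: "corner_inv (Q n) x u" using Qx by blast
    have "R * x * Q n = 0" using R(4) xQ[of n] by (metis mult.assoc mult_zero_left)
    then have "corner_inv (Q n + R) x (u + v - u * x * v)"
      using u v R Q by (intro corner_inv_triangular)
    then have "x \<in> invertibles" by (auto simp: R_def corner_inv_1 intro: invertiblesI)
    then show ?thesis by (simp add: x_def algebra_simps)
  qed
  then have "spectrum (a - d) \<subseteq> \<Omega>" unfolding spectrum_iff subset_iff by blast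
  ultimately show thesis using that d(2) by blast
qed

theorem corollary2p1:
  fixes T :: "'a::cstar_algebra \<Rightarrow> 'b::cstar_algebra"
    and a :: 'a and \<Omega> :: "complex set"
  assumes "unital_hom T" and "bounded_linear T"
    and "riesz_property T"
    and "generalized_riesz_with T a \<Omega>"
  shows "\<exists>d c. a = d + c \<and> normal_elem d \<and> d \<in> null_space T \<and> spectrum c = \<Omega>"
proof -
  note T = assms(1,2)
  have \<Omega>: "finite \<Omega>" "spectrum (T a) = \<Omega>" "browder_spectrum T a = \<Omega>"
    using assms(4) by (auto simp: generalized_riesz_with_def hom_spectrum_def)
  \<comment> \<open>Nonemptiness provides nearest points in \<Omega> and makes
    \<open>infdist\<close> positive off \<Omega>.\<close>
  have "\<Omega> \<noteq> {}" using spectrum_nonempty[of "T a"] \<Omega> by simp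
  have "closed \<Omega>" using \<Omega> finite_imp_closed by blast

  \<comment> \<open>Isolation of spectral points off \<Omega> and choice of their Riesz
    idempotents\<close>
  have "\<exists>\<rho>>0. \<forall>z. 0 < cmod (z - \<mu>) \<and> cmod (z - \<mu>) \<le> \<rho> \<longrightarrow> z \<notin> spectrum a" if "\<mu> \<notin> \<Omega>" for \<mu>
  proof -
    have "of_complex \<mu> - a \<in> browder_elems T"
      using that \<Omega>(3) by (auto simp: browder_spectrum_def of_complex_def)
    then have "\<forall>\<^sub>F z in at 0. of_complex z + (of_complex \<mu> - a) \<in> invertibles"
      by (intro browder_elem_isolated[OF T assms(3)])
    then obtain \<delta> where \<delta>: "\<delta> > 0"
      "\<And>z. z \<noteq> 0 \<Longrightarrow> cmod z < \<delta> \<Longrightarrow> of_complex z + (of_complex \<mu> - a) \<in> invertibles"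
      by (auto simp: eventually_at)
    have "z \<notin> spectrum a" if "0 < cmod (z - \<mu>)" "cmod (z - \<mu>) \<le> \<delta> / 2" for z
    proof -
      have "cmod (z - \<mu>) < \<delta>" "z - \<mu> \<noteq> 0" using that \<delta>(1) by auto
      from \<delta>(2)[OF this(2,1)] show ?thesis by (simp add: of_complex_diff spectrum_iff)
    qed
    then show ?thesis using \<delta>(1) by (intro exI[of _ "\<delta> / 2"]) simp
  qed
  then obtain \<rho> where \<rho>: "\<And>\<mu>. \<mu> \<notin> \<Omega> \<Longrightarrow> \<rho> \<mu> > 0"
    "\<And>\<mu> z. \<mu> \<notin> \<Omega> \<Longrightarrow> 0 < cmod (z - \<mu>) \<Longrightarrow> cmod (z - \<mu>) \<le> \<rho> \<mu> \<Longrightarrow> z \<notin> spectrum a"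
    by metis
  define good where "good = (\<lambda>\<mu> p. p * p = p \<and> p * a = a * p \<and>
    (\<forall>\<zeta>. \<zeta> \<noteq> \<mu> \<longrightarrow> (\<exists>w. corner_inv p (of_complex \<zeta> - a) w)) \<and>
    (\<exists>w. corner_inv (1 - p) (of_complex \<mu> - a) w) \<and>
    (\<forall>q. q * q = q \<longrightarrow> q * a = a * q \<longrightarrow>
      (\<forall>\<zeta>. cmod (\<zeta> - \<mu>) \<le> \<rho> \<mu> \<longrightarrow> (\<exists>w. corner_inv q (of_complex \<zeta> - a) w)) \<longrightarrow> q * p = 0) \<and>
    T p = 0)"
  have "\<exists>p. good \<mu> p" if \<mu>: "\<mu> \<notin> \<Omega>" for \<mu>
  proof -
    have notin: "\<mu> \<notin> spectrum (T a)" using \<mu> \<Omega> by simp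
    show ?thesis
    proof (rule riesz_idempotent[OF \<rho>(1)[OF \<mu>] \<rho>(2)[OF \<mu>] T notin])
      fix p assume p: "p * p = p" "\<And>x. x * a = a * x \<Longrightarrow> x * p = p * x"
        "\<And>\<zeta>. \<zeta> \<noteq> \<mu> \<Longrightarrow> \<exists>w. corner_inv p (of_complex \<zeta> - a) w"
        "\<exists>w. corner_inv (1 - p) (of_complex \<mu> - a) w"
        "\<And>q. q * q = q \<Longrightarrow> q * a = a * q \<Longrightarrow>
          (\<And>\<zeta>. cmod (\<zeta> - \<mu>) \<le> \<rho> \<mu> \<Longrightarrow> \<exists>w. corner_inv q (of_complex \<zeta> - a) w) \<Longrightarrow> q * p = 0"
        "T p = 0"
      have "p * a = a * p" using p(2)[OF refl] by (rule sym)
      then have "good \<mu> p" unfolding good_def using p(1,3,4,5,6) by blast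
      then show "\<exists>p. good \<mu> p" ..
    qed
  qed
  then obtain pp where "\<And>\<mu>. \<mu> \<notin> \<Omega> \<Longrightarrow> good \<mu> (pp \<mu>)" by metis
  then have pp: "pp \<mu> * pp \<mu> = pp \<mu>" "pp \<mu> * a = a * pp \<mu>"
      "\<And>\<zeta>. \<zeta> \<noteq> \<mu> \<Longrightarrow> \<exists>w. corner_inv (pp \<mu>) (of_complex \<zeta> - a) w"
      "\<exists>w. corner_inv (1 - pp \<mu>) (of_complex \<mu> - a) w"
      "\<And>q. q * q = q \<Longrightarrow> q * a = a * q \<Longrightarrow>
        (\<And>\<zeta>. cmod (\<zeta> - \<mu>) \<le> \<rho> \<mu> \<Longrightarrow> \<exists>w. corner_inv q (of_complex \<zeta> - a) w) \<Longrightarrow> q * pp \<mu> = 0"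
      "T (pp \<mu>) = 0" if "\<mu> \<notin> \<Omega>" for \<mu>
    using that unfolding good_def by blast+
  define S where "S = spectrum a - \<Omega>"
  \<comment> \<open>The corner of \<open>pp \<mu>\<close> carries no spectrum of a except \<mu>, and
    \<mu> is not in the disc about \<nu>, where only \<nu> can be spectral. So
    \<open>pp \<mu>\<close> annihilates \<open>pp \<nu>\<close>.\<close>
  have pp_orth: "pp \<mu> * pp \<nu> = 0" if "\<mu> \<in> S" "\<nu> \<in> S" "\<mu> \<noteq> \<nu>" for \<mu> \<nu>
  proof -
    have \<mu>\<nu>: "\<mu> \<notin> \<Omega>" "\<nu> \<notin> \<Omega>" "\<mu> \<in> spectrum a" using that by (auto simp: S_def)
    have "\<exists>w. corner_inv (pp \<mu>) (of_complex \<zeta> - a) w" if "cmod (\<zeta> - \<nu>) \<le> \<rho> \<nu>" for \<zeta>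
    proof -
      have "\<zeta> \<noteq> \<mu>" using \<rho>(2)[OF \<mu>\<nu>(2), of \<mu>] that \<mu>\<nu>(3) \<open>\<mu> \<noteq> \<nu>\<close> by auto
      then show ?thesis by (rule pp(3)[OF \<mu>\<nu>(1)])
    qed
    then show ?thesis by (rule pp(5)[OF \<mu>\<nu>(2) pp(1)[OF \<mu>\<nu>(1)] pp(2)[OF \<mu>\<nu>(1)]])
  qed
  \<comment> \<open>The spectral points at distance at least \<epsilon> from \<Omega>: a compact set
    in which every point is isolated, hence finite.\<close>
  define K where "K = (\<lambda>\<epsilon>. {\<mu> \<in> spectrum a. \<epsilon> \<le> infdist \<mu> \<Omega>})"
  have fin_K: "finite (K \<epsilon>)" if "\<epsilon> > 0" for \<epsilon>
  proof (rule ccontr)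
    assume inf: "infinite (K \<epsilon>)"
    have K_eq: "K \<epsilon> = spectrum a \<inter> (\<lambda>\<mu>. infdist \<mu> \<Omega>) -` {\<epsilon>..}" by (auto simp: K_def)
    have "closed ((\<lambda>\<mu>. infdist \<mu> \<Omega>) -` {\<epsilon>..})"
      by (intro closed_vimage continuous_intros)
    then have "closed (K \<epsilon>)" unfolding K_eq using closed_spectrum by (intro closed_Int)
    moreover have "bounded (K \<epsilon>)"
      unfolding bounded_iff by (auto simp: K_def intro!: exI[of _ "norm a"] spectrum_norm_le)
    ultimately have "compact (K \<epsilon>)" by (simp add: compact_eq_bounded_closed)
    then obtain \<mu> where \<mu>: "\<mu> \<in> K \<epsilon>" "\<mu> islimpt K \<epsilon>"
      using inf by (meson compact_eq_Bolzano_Weierstrass order_refl)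
    then have "\<mu> \<notin> \<Omega>" using \<open>\<epsilon> > 0\<close> by (auto simp: K_def)
    obtain z where "z \<in> K \<epsilon>" "z \<noteq> \<mu>" "dist z \<mu> < \<rho> \<mu>"
      using \<mu>(2) \<rho>(1)[OF \<open>\<mu> \<notin> \<Omega>\<close>] unfolding islimpt_approachable by blast
    then show False using \<rho>(2)[OF \<open>\<mu> \<notin> \<Omega>\<close>, of z] by (auto simp: dist_norm K_def)
  qed

  \<comment> \<open>Enumeration of the spectral points off \<Omega>\<close>
  have "S \<subseteq> (\<Union>n. K (1 / real (Suc n)))"
  proof
    fix \<mu> assume "\<mu> \<in> S"
    then have "infdist \<mu> \<Omega> > 0"
      using infdist_pos_not_in_closed[OF \<open>closed \<Omega>\<close> \<open>\<Omega> \<noteq> {}\<close>] by (auto simp: S_def)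
    then obtain n where "1 / real (Suc n) < infdist \<mu> \<Omega>"
      using reals_Archimedean by (auto simp: inverse_eq_divide)
    then show "\<mu> \<in> (\<Union>n. K (1 / real (Suc n)))"
      using \<open>\<mu> \<in> S\<close> by (auto simp: K_def S_def intro!: less_imp_le)
  qed
  moreover have "countable (K (1 / real (Suc n)))" for n
    by (intro countable_finite fin_K) simp
  then have "countable (\<Union>n. K (1 / real (Suc n)))" by simp
  ultimately have "countable S" by (rule countable_subset)
  define g where "g = to_nat_on S"
  have g: "inj_on g S" unfolding g_def using \<open>countable S\<close> by (rule inj_on_to_nat_on)
  obtain \<omega> where "\<omega> \<in> \<Omega>" using \<open>\<Omega> \<noteq> {}\<close> by blast
  have "\<forall>\<mu>. \<exists>\<nu>. \<nu> \<in> \<Omega> \<and> infdist \<mu> \<Omega> = dist \<mu> \<nu>"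
    using infdist_attains_inf[OF \<open>closed \<Omega>\<close> \<open>\<Omega> \<noteq> {}\<close>] by metis
  then obtain near where near: "\<And>\<mu>. near \<mu> \<in> \<Omega>" "\<And>\<mu>. infdist \<mu> \<Omega> = dist \<mu> (near \<mu>)"
    by metis
  \<comment> \<open>Indices that enumerate no point get the idempotent 0 and equal points
    \<open>l i\<close> = \<open>m i\<close> = \<omega>, so they contribute nothing to the
    series.\<close>
  define p where "p = (\<lambda>i. if i \<in> g ` S then pp (inv_into S g i) else 0)"
  define l where "l = (\<lambda>i. if i \<in> g ` S then inv_into S g i else \<omega>)"
  define m where "m = (\<lambda>i. if i \<in> g ` S then near (inv_into S g i) else \<omega>)"
  have on_S: "p (g \<mu>) = pp \<mu>" "l (g \<mu>) = \<mu>" "m (g \<mu>) = near \<mu>" if "\<mu> \<in> S" for \<mu>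
    using that g by (simp_all add: p_def l_def m_def)
  have off_S: "p i = 0" "l i = \<omega>" "m i = \<omega>" if "i \<notin> g ` S" for i
    using that by (simp_all add: p_def l_def m_def)
  have S\<Omega>: "\<mu> \<notin> \<Omega>" if "\<mu> \<in> S" for \<mu> using that by (simp add: S_def)
  have p_cases: "Q i" if "\<And>\<mu>. \<mu> \<in> S \<Longrightarrow> Q (g \<mu>)" "i \<notin> g ` S \<Longrightarrow> Q i" for Q i
    using that by blast
  have lim: "(\<lambda>i. l i - m i) \<longlonglongrightarrow> 0"
  proof (rule tendstoI)
    fix \<epsilon> :: real assume "\<epsilon> > 0"
    \<comment> \<open>For an enumerated point \<bar>\<open>l i\<close> - \<open>m i\<close>\<bar> is
      its distance to \<Omega>, so large differences occur only on the finite set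
      \<open>K \<epsilon>\<close>.\<close>
    have "{i. \<not> dist (l i - m i) 0 < \<epsilon>} \<subseteq> g ` K \<epsilon>"
    proof
      fix i assume i: "i \<in> {i. \<not> dist (l i - m i) 0 < \<epsilon>}"
      then have "i \<in> g ` S" using \<open>\<epsilon> > 0\<close> by (cases "i \<in> g ` S") (simp_all add: off_S)
      then obtain \<mu> where "\<mu> \<in> S" "i = g \<mu>" by blast
      then show "i \<in> g ` K \<epsilon>" using i near(2)[of \<mu>] by (auto simp: on_S K_def S_def dist_norm)
    qed
    then have "finite {i. \<not> dist (l i - m i) 0 < \<epsilon>}"
      using fin_K[OF \<open>\<epsilon> > 0\<close>] finite_surj by blast
    then show "\<forall>\<^sub>F i in sequentially. dist (l i - m i) 0 < \<epsilon>"
      by (simp add: eventually_cofinite flip: cofinite_eq_sequentially)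
  qed
  obtain d where d: "normal_elem d" "T d = 0" "spectrum (a - d) \<subseteq> \<Omega>"
  proof (rule west_decomposition[where p = p and l = l and m = m and a = a and \<Omega> = \<Omega> and T = T])
    show "p i * p i = p i" "p i * a = a * p i" "T (p i) = 0" for i
      by (rule p_cases[of _ i]; use T in \<open>simp add: on_S off_S pp S\<Omega> unital_hom_0\<close>)+
    show "p i * p j = 0" if "i \<noteq> j" for i j
    proof (cases "i \<in> g ` S \<and> j \<in> g ` S")
      case True
      then show ?thesis using that by (auto simp: on_S intro!: pp_orth)
    qed (auto simp: off_S)
    show "\<exists>w. corner_inv (p i) (of_complex \<zeta> - a) w" if "\<zeta> \<noteq> l i" for i \<zeta>
    proof (cases "i \<in> g ` S")
      case True
      then obtain \<mu> where "\<mu> \<in> S" "i = g \<mu>" by blast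
      then show ?thesis using that pp(3)[OF S\<Omega>] by (simp add: on_S)
    next
      case False
      then show ?thesis using corner_inv_0 by (auto simp: off_S)
    qed
    show "\<exists>s \<in> insert 0 (range p). \<exists>w. corner_inv (1 - s) (of_complex \<mu> - a) w" if "\<mu> \<notin> \<Omega>" for \<mu>
    proof (cases "\<mu> \<in> S")
      case True
      then show ?thesis using pp(4)[OF that] on_S(1) by (metis insertI2 rangeI)
    next
      case False
      then have "of_complex \<mu> - a \<in> invertibles" using that by (simp add: S_def spectrum_iff)
      then have "corner_inv (1 - 0) (of_complex \<mu> - a) (invel (of_complex \<mu> - a))"
        by (simp add: corner_inv_1 invel_left invel_right)
      then show ?thesis by blast
    qed
    show "m i \<in> \<Omega>" for i by (simp add: m_def near \<open>\<omega> \<in> \<Omega>\<close>)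
  qed (use lim T in auto)
  \<comment> \<open>The reverse inclusion: \<Omega> is the spectrum of \<open>T a\<close> =
    \<open>T (a - d)\<close>, and a unital homomorphism cannot enlarge the spectrum.\<close>
  have "T (a - d) = T a" using T d by (simp add: unital_hom_diff)
  then have "\<Omega> \<subseteq> spectrum (a - d)"
    using spectrum_unital_hom[OF T(1), of "a - d"] \<Omega> by simp
  with d show ?thesis
    by (intro exI[of _ d] exI[of _ "a - d"]) (auto simp: null_space_def)
qed

end
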